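(* Let $G$ be a graph with $n(G)\ge 2$ and let $T$ be a tree with a perfect matching. Then $$\gamma_{\mathrm{MB}}(G\odot T)=\left\lceil \tfrac{n(G)}{2}\right\rceil+\left\lfloor \tfrac{n(G)}{2}\right\rfloor\tfrac{n(T)}{2}\quad\text{and}\quad \gamma_{\mathrm{MB}}'(G\odot T)=\left\lfloor \tfrac{n(G)}{2}\right\rfloor+\left\lceil \tfrac{n(G)}{2}\right\rceil\tfrac{n(T)}{2}.$$
   Context: All graphs are finite and simple; $n(G)$ denotes the order of $G$. The Maker-Breaker domination game on a graph $G$: Dominator and Staller alternately select a not yet selected vertex of $G$. Dominator wins if his selected vertices contain a dominating set of $G$; Staller wins if she selects at least one vertex from every dominating set of $G$. In the D-game Dominator moves first, in the S-game Staller moves first. $\gamma_{\mathrm{MB}}(G)$ (resp. $\gamma_{\mathrm{MB}}'(G)$) is the minimum number of moves Dominator needs to win the D-game (resp. S-game) on $G$ when both players play optimally, and is $\infty$ if Dominator has no winning strategy. The corona $G\odot H$ is obtained from one copy of $G$ and $n(G)$ disjoint copies of $H$ by joining the $i$-th vertex of $G$ to every vertex of the $i$-th copy of $H$. *)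

theory Defs
  imports
    Complex_Main
    "HOL-Library.Extended_Nat"
    "Graph_Theory.Graph_Theory"
begin

text \<open>
  A finite simple graph is a \<^locale>\<open>pair_graph\<close>: a finite, loop-free, symmetric set of arcs
  without parallel arcs, each edge being represented by its two orientations.
\<close>

abbreviation graph_order :: "'a pair_pre_digraph \<Rightarrow> nat" where
  "graph_order G \<equiv> card (pverts G)"

definition edges :: "'a pair_pre_digraph \<Rightarrow> 'a set set" where
  "edges G = {{u, v} |u v. (u, v) \<in> parcs G}"

text \<open>
  The constant \<open>tree\<close> of \<^theory>\<open>Graph_Theory.Digraph_Component\<close> is about digraphs and does not fit
  here: it counts the closed walk u, v, u along one edge as a cycle, so that no symmetric graph
  with an edge is a tree. In a simple graph the cycles of that library of length at least 3
  are exactly the (oriented) graph cycles. Connectedness includes non-emptiness.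
\<close>

definition is_tree :: "'a pair_pre_digraph \<Rightarrow> bool" where
  "is_tree T \<longleftrightarrow> pair_graph T \<and> Digraph_Component.connected (with_proj T) \<and>
     \<not> (\<exists>p. pre_digraph.cycle (with_proj T) p \<and> length p \<ge> 3)"

definition perfect_matching :: "'a pair_pre_digraph \<Rightarrow> 'a set set \<Rightarrow> bool" where
  "perfect_matching G M \<longleftrightarrow> M \<subseteq> edges G \<and> pairwise disjnt M \<and> \<Union>M = pverts G"

text \<open>
  In the corona, \<open>Inl u\<close> is the vertex u of G and \<open>Inr (u, x)\<close> is the vertex x of the copy of H
  that belongs to u.
\<close>

definition corona ::
  "'a pair_pre_digraph \<Rightarrow> 'b pair_pre_digraph \<Rightarrow> ('a + 'a \<times> 'b) pair_pre_digraph" (infixl \<open>\<odot>\<close> 70)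
where
  "G \<odot> H = \<lparr>
     pverts = Inl ` pverts G \<union> Inr ` (pverts G \<times> pverts H),
     parcs = {(Inl u, Inl v) |u v. (u, v) \<in> parcs G}
       \<union> {(Inr (u, x), Inr (u, y)) |u x y. u \<in> pverts G \<and> (x, y) \<in> parcs H}
       \<union> {(Inl u, Inr (u, x)) |u x. u \<in> pverts G \<and> x \<in> pverts H}
       \<union> {(Inr (u, x), Inl u) |u x. u \<in> pverts G \<and> x \<in> pverts H} \<rparr>"

lemma pair_graph_corona:
  assumes "pair_graph G" "pair_graph H"
  shows "pair_graph (G \<odot> H)"
proof -
  interpret G: pair_graph G by fact
  interpret H: pair_graph H by fact
  have wf: "parcs (G \<odot> H) \<subseteq> pverts (G \<odot> H) \<times> pverts (G \<odot> H)"
    by (auto simp: corona_def dest: G.in_arcsD1 G.in_arcsD2 H.in_arcsD1 H.in_arcsD2)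
  have fin: "finite (pverts (G \<odot> H))"
    by (auto simp: corona_def G.pair_finite_verts H.pair_finite_verts)
  have "finite (parcs (G \<odot> H))"
    using finite_subset[OF wf] fin by blast
  moreover have "symmetric (with_proj (G \<odot> H))"
    using G.pair_sym_arcs H.pair_sym_arcs
    by (auto simp: symmetric_def corona_def sym_def)
  moreover have "fst e \<noteq> snd e" if "e \<in> parcs (G \<odot> H)" for e
    using that G.pair_no_loops H.pair_no_loops by (fastforce simp: corona_def)
  ultimately show ?thesis
    using wf fin by unfold_locales auto
qed

definition dominating_set :: "'a pair_pre_digraph \<Rightarrow> 'a set \<Rightarrow> bool" where
  "dominating_set G D \<longleftrightarrow>
     D \<subseteq> pverts G \<and> (\<forall>v \<in> pverts G. v \<in> D \<or> (\<exists>u \<in> D. (u, v) \<in> parcs G))"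

text \<open>
  The Maker-Breaker domination game. A play is the list of the vertices selected so far, in the
  order of their selection; its element with index i is selected by Dominator iff
  \<open>dominator_turn first i\<close>, where \<open>first\<close> is the player who starts. Plays are continued
  until all vertices are selected; moves made after Dominator has won are not counted.
\<close>

datatype player = Dominator | Staller

definition dominator_turn :: "player \<Rightarrow> nat \<Rightarrow> bool" where
  "dominator_turn first i \<longleftrightarrow> (case first of Dominator \<Rightarrow> even i | Staller \<Rightarrow> odd i)"

definition dominator_moves :: "player \<Rightarrow> 'a list \<Rightarrow> 'a list" where
  "dominator_moves first p = nths p {i. dominator_turn first i}"

definition complete_plays :: "'a pair_pre_digraph \<Rightarrow> 'a list set" where
  "complete_plays G = {p. distinct p \<and> set p = pverts G}"

text \<open>A strategy for Dominator maps each history with Dominator to move to an unselected vertex.\<close>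

definition dominator_strategies :: "player \<Rightarrow> 'a pair_pre_digraph \<Rightarrow> ('a list \<Rightarrow> 'a) set" where
  "dominator_strategies first G = {\<sigma>. \<forall>h. distinct h \<and> set h \<subset> pverts G \<and>
     dominator_turn first (length h) \<longrightarrow> \<sigma> h \<in> pverts G - set h}"

definition follows_strategy :: "player \<Rightarrow> ('a list \<Rightarrow> 'a) \<Rightarrow> 'a list \<Rightarrow> bool" where
  "follows_strategy first \<sigma> p \<longleftrightarrow>
     (\<forall>i < length p. dominator_turn first i \<longrightarrow> p ! i = \<sigma> (take i p))"

definition dominator_has_won :: "player \<Rightarrow> 'a pair_pre_digraph \<Rightarrow> 'a list \<Rightarrow> bool" where
  "dominator_has_won first G p \<longleftrightarrow> (\<exists>D \<subseteq> set (dominator_moves first p). dominating_set G D)"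

text \<open>
  The number of moves Dominator has made when he first wins in the play p. It is \<open>\<infinity>\<close>, the infimum
  of the empty set, if he never wins, that is, if Staller wins.
\<close>

definition moves_to_win :: "player \<Rightarrow> 'a pair_pre_digraph \<Rightarrow> 'a list \<Rightarrow> enat" where
  "moves_to_win first G p =
     (INF n \<in> {n. n \<le> length p \<and> dominator_has_won first G (take n p)}.
        enat (length (dominator_moves first (take n p))))"

text \<open>
  Optimal play: Dominator minimizes over his strategies the worst case over all replies of
  Staller. The value is \<open>\<infinity>\<close> iff each of his strategies loses some play.
\<close>

definition game_value :: "player \<Rightarrow> 'a pair_pre_digraph \<Rightarrow> enat" where
  "game_value first G =
     (INF \<sigma> \<in> dominator_strategies first G.
        SUP p \<in> {p \<in> complete_plays G. follows_strategy first \<sigma> p}. moves_to_win first G p)"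

definition gamma_MB :: "'a pair_pre_digraph \<Rightarrow> enat" where
  "gamma_MB = game_value Dominator"

definition gamma_MB' :: "'a pair_pre_digraph \<Rightarrow> enat" where
  "gamma_MB' = game_value Staller"

end

theory Submission
  imports Defs
begin

text \<open>
  A set dominates the corona iff for each vertex u of G (a \<^emph>\<open>hub\<close>) it contains u or dominates the
  copy of T at u (its \<^emph>\<open>branch\<close>). Let \<open>m\<close> be half the order of T. Dominator secures his share of the
  hubs, answering a move in the branch of a free hub by taking that hub, and in the branches of
  Staller's hubs he selects one vertex from each matched pair, which costs at most \<open>m\<close> moves per branch.

  Staller first takes hubs as long as there are any. A move that Dominator spends outside the hubs
  in this phase gives Staller half a hub more, so at its end she still owns her share of hubs in
  whose branches Dominator has selected at most one vertex z. The rest of such a branch can be peeled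
  off in matched pairs (x, y) in which x is currently a leaf: an endpoint of a longest path together
  with its neighbour, where one of the two ends of the path avoids z. Whenever Staller selects y,
  Dominator is forced to select x. These \<open>m - 1\<close> replies do not dominate z, so the branch costs
  him \<open>m\<close> moves.
\<close>

section \<open>Positions and bounds on the value of the game\<close>

text \<open>The invariants of both players depend only on who owns which vertices; together with
  \<open>stal_part\<close> this forgets the order of play.\<close>

definition dom_part :: "player \<Rightarrow> 'v list \<Rightarrow> 'v set" where
  "dom_part first h = set (dominator_moves first h)"

definition stal_part :: "player \<Rightarrow> 'v list \<Rightarrow> 'v set" where
  "stal_part first h = set h - dom_part first h"

definition position :: "'v pair_pre_digraph \<Rightarrow> 'v set \<Rightarrow> 'v set \<Rightarrow> bool" where
  "position H A S \<longleftrightarrow> A \<subseteq> pverts H \<and> S \<subseteq> pverts H \<and> A \<inter> S = {}"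

lemma dominator_moves_Nil [simp]: "dominator_moves first [] = []"
  by (simp add: dominator_moves_def)

lemma dominator_moves_snoc:
  "dominator_moves first (h @ [x]) =
     (if dominator_turn first (length h) then dominator_moves first h @ [x]
      else dominator_moves first h)"
  by (simp add: dominator_moves_def nths_append)

lemma dom_part_subset: "dom_part first h \<subseteq> set h"
  by (auto simp: dom_part_def dominator_moves_def dest: in_set_nthsD)

lemma dom_part_Un_stal_part: "dom_part first h \<union> stal_part first h = set h"
  using dom_part_subset[of first h] by (auto simp: stal_part_def)

lemma dom_part_Nil [simp]: "dom_part first [] = {}" "stal_part first [] = {}"
  by (simp_all add: dom_part_def stal_part_def)

lemma dom_part_snoc_dominator:
  assumes "dominator_turn first (length h)" "x \<notin> set h"
  shows "dom_part first (h @ [x]) = insert x (dom_part first h)"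
    "stal_part first (h @ [x]) = stal_part first h"
  using assms by (auto simp: dom_part_def stal_part_def dominator_moves_snoc)

lemma dom_part_snoc_staller:
  assumes "\<not> dominator_turn first (length h)" "x \<notin> set h"
  shows "dom_part first (h @ [x]) = dom_part first h"
    "stal_part first (h @ [x]) = insert x (stal_part first h)"
  using assms dom_part_subset[of first h]
  by (auto simp: dom_part_def stal_part_def dominator_moves_snoc)

lemma dominator_turn_Suc: "dominator_turn first (Suc n) \<longleftrightarrow> \<not> dominator_turn first n"
  by (cases first) (auto simp: dominator_turn_def)

lemma dominator_turn_0: "dominator_turn first 0 \<longleftrightarrow> first = Dominator"
  by (cases first) (auto simp: dominator_turn_def)

lemma length_dominator_moves:
  assumes "distinct h"
  shows "length (dominator_moves first h) = card (dom_part first h)"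
  using assms by (simp add: dom_part_def dominator_moves_def distinct_card)

lemma position_parts:
  assumes "set h \<subseteq> pverts H"
  shows "position H (dom_part first h) (stal_part first h)"
  using assms dom_part_subset[of first h] by (auto simp: position_def stal_part_def)

lemma dominating_set_mono:
  assumes "dominating_set H D" "D \<subseteq> A" "A \<subseteq> pverts H"
  shows "dominating_set H A"
  using assms by (auto simp: dominating_set_def) blast

lemma dominator_has_won_iff:
  assumes "set h \<subseteq> pverts H"
  shows "dominator_has_won first H h \<longleftrightarrow> dominating_set H (dom_part first h)"
proof -
  have "dom_part first h \<subseteq> pverts H"
    using assms dom_part_subset by fast
  then show ?thesis
    unfolding dominator_has_won_def dom_part_def[symmetric] by (auto intro: dominating_set_mono)
qed

section \<open>Invariants that bound the value of the game from above and from below\<close>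

text \<open>\<open>QD\<close> is kept when Dominator is to move and \<open>QS\<close> when Staller
  is. A new win arises only from his own move, so \<open>won\<close> is asked for \<open>QS\<close>
  alone; on a full board \<open>full\<close> makes him the winner.\<close>

lemma game_value_leI:
  assumes init: "if first = Dominator then QD {} {} else QS {} {}"
    and staller: "\<And>A S x. \<lbrakk>QS A S; position H A S; \<not> dominating_set H A; x \<in> pverts H - (A \<union> S)\<rbrakk>
      \<Longrightarrow> QD A (insert x S)"
    and dominator: "\<And>A S. \<lbrakk>QD A S; position H A S; \<not> dominating_set H A\<rbrakk>
      \<Longrightarrow> \<exists>x \<in> pverts H - (A \<union> S). QS (insert x A) S"
    and won: "\<And>A S. \<lbrakk>QS A S; position H A S; dominating_set H A\<rbrakk> \<Longrightarrow> card A \<le> B"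
    and full: "\<And>A S. \<lbrakk>QS A S; position H A S; pverts H \<subseteq> A \<union> S\<rbrakk> \<Longrightarrow> dominating_set H A"
  shows "game_value first H \<le> enat B"
proof -
  let ?A = "dom_part first" and ?S = "stal_part first"
  define good where
    "good h x \<longleftrightarrow> x \<in> pverts H - set h \<and> QS (insert x (?A h)) (?S h)" for h x
  \<comment> \<open>A strategy must be defined on every history, so where no move leads to
    \<open>QS\<close> an arbitrary unselected vertex is taken.\<close>
  define \<sigma> where "\<sigma> h = (if \<exists>x. good h x then SOME x. good h x else SOME x. x \<in> pverts H - set h)" for h
  have \<sigma>_good: "good h (\<sigma> h)" if "good h x" for h x
    using that unfolding \<sigma>_def by (auto intro: someI)
  have "\<sigma> h \<in> pverts H - set h" if "set h \<subset> pverts H" for h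
  proof (cases "\<exists>x. good h x")
    case True
    then show ?thesis using \<sigma>_good good_def by blast
  next
    case False
    have "\<exists>x. x \<in> pverts H - set h" using that by blast
    from someI_ex[OF this] False show ?thesis by (simp add: \<sigma>_def)
  qed
  then have strat: "\<sigma> \<in> dominator_strategies first H"
    by (auto simp: dominator_strategies_def)
  have "moves_to_win first H p \<le> enat B"
    if p: "p \<in> complete_plays H" and follows: "follows_strategy first \<sigma> p" for p
  proof -
    have dist: "distinct p" and setp: "set p = pverts H"
      using p by (auto simp: complete_plays_def)
    \<comment> \<open>The play goes on after a win, when the invariant is no longer maintained;
      \<open>Won i\<close> remembers a cheap win among the first i moves.\<close>
    define Won where "Won i \<longleftrightarrow> (\<exists>j \<le> i. dominating_set H (?A (take j p)) \<and> card (?A (take j p)) \<le> B)" for i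
    define Q where "Q h \<longleftrightarrow> (if dominator_turn first (length h) then QD (?A h) (?S h) else QS (?A h) (?S h))" for h
    have inv: "Won i \<or> (Q (take i p) \<and> \<not> dominating_set H (?A (take i p)))" if "i \<le> length p" for i
      using that
    proof (induction i)
      case 0
      have "Q []" using init by (auto simp: Q_def dominator_turn_0)
      then show ?case by (auto simp: Won_def)
    next
      case (Suc i)
      let ?h = "take i p" and ?x = "p ! i"
      have i: "i < length p" using Suc.prems by simp
      have tk: "take (Suc i) p = ?h @ [?x]" using i by (simp add: take_Suc_conv_app_nth)
      have len: "length ?h = i" "length (take (Suc i) p) = Suc i" using i by simp_all
      have x: "?x \<notin> set ?h"
        using distinct_take[OF dist, of "Suc i"] unfolding tk by simp
      have xV: "?x \<in> pverts H" using i setp nth_mem by blast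
      have hV: "set ?h \<subseteq> pverts H" using setp set_take_subset by fast
      have pos: "position H (?A ?h) (?S ?h)" by (rule position_parts[OF hV])
      have un: "?A ?h \<union> ?S ?h = set ?h" by (rule dom_part_Un_stal_part)
      show ?case
      proof (cases "Won i")
        case True
        then show ?thesis using le_SucI by (auto simp: Won_def)
      next
        case False
        with Suc have Q: "Q ?h" and nd: "\<not> dominating_set H (?A ?h)" by auto
        show ?thesis
        proof (cases "dominator_turn first i")
          case True
          have "\<exists>x \<in> pverts H - (?A ?h \<union> ?S ?h). QS (insert x (?A ?h)) (?S ?h)"
            using dominator[OF _ pos nd] Q True len by (simp add: Q_def)
          then obtain y where "good ?h y" by (auto simp: good_def un)
          then have "good ?h (\<sigma> ?h)" by (rule \<sigma>_good)
          moreover have "?x = \<sigma> ?h" using follows i True by (simp add: follows_strategy_def)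
          ultimately have g: "QS (insert ?x (?A ?h)) (?S ?h)" by (simp add: good_def)
          have parts: "?A (take (Suc i) p) = insert ?x (?A ?h)" "?S (take (Suc i) p) = ?S ?h"
            unfolding tk using dom_part_snoc_dominator[OF _ x] True len by auto
          have pos': "position H (?A (take (Suc i) p)) (?S (take (Suc i) p))"
            by (rule position_parts) (use setp set_take_subset in fast)
          have Q': "Q (take (Suc i) p)"
            using g parts True len by (simp add: Q_def dominator_turn_Suc del: length_take)
          show ?thesis
          proof (cases "dominating_set H (?A (take (Suc i) p))")
            case True
            then have "card (?A (take (Suc i) p)) \<le> B"
              using won[OF _ pos'] g parts by simp
            with True show ?thesis by (auto simp: Won_def)
          qed (use Q' in blast)
        next
          case False
          have parts: "?A (take (Suc i) p) = ?A ?h" "?S (take (Suc i) p) = insert ?x (?S ?h)"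
            unfolding tk using dom_part_snoc_staller[OF _ x] False len by auto
          have "QD (?A ?h) (insert ?x (?S ?h))"
            using staller[OF _ pos nd] Q False len x xV un by (simp add: Q_def)
          then have "Q (take (Suc i) p)"
            using parts False len by (simp add: Q_def dominator_turn_Suc del: length_take)
          then show ?thesis using nd parts by simp
        qed
      qed
    qed
    have pos: "position H (?A p) (?S p)" by (rule position_parts) (simp add: setp)
    have un: "?A p \<union> ?S p = pverts H" using dom_part_Un_stal_part setp by metis
    have "Won (length p)"
    proof (rule ccontr)
      assume "\<not> Won (length p)"
      with inv[of "length p"] have Q: "Q p" and nd: "\<not> dominating_set H (?A p)" by auto
      show False
      proof (cases "dominator_turn first (length p)")
        case True
        with Q have "QD (?A p) (?S p)" by (simp add: Q_def)
        from dominator[OF this pos nd] show False using un by auto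
      next
        case False
        with Q have "QS (?A p) (?S p)" by (simp add: Q_def)
        from full[OF this pos] nd show False using un by auto
      qed
    qed
    then obtain j where j: "j \<le> length p" "dominating_set H (?A (take j p))"
      "card (?A (take j p)) \<le> B" by (auto simp: Won_def)
    have "dominator_has_won first H (take j p)"
      using j(2) dominator_has_won_iff[of "take j p"] setp set_take_subset by metis
    then have "moves_to_win first H p \<le> enat (length (dominator_moves first (take j p)))"
      unfolding moves_to_win_def using j(1) by (intro INF_lower) simp
    also have "\<dots> \<le> enat B"
      using j(3) dist by (simp add: length_dominator_moves)
    finally show ?thesis .
  qed
  then have "(SUP p \<in> {p \<in> complete_plays H. follows_strategy first \<sigma> p}. moves_to_win first H p) \<le> enat B"
    by (intro SUP_least) auto
  then show ?thesis
    unfolding game_value_def using strat by (rule INF_lower2[rotated])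
qed

text \<open>Against each strategy of Dominator a complete play is built in which the invariant holds
  at every prefix. So every winning prefix contains at least \<open>B\<close> of his moves, and
  without one the infimum is infinite.\<close>

lemma game_value_geI:
  assumes fin: "finite (pverts H)"
    and init: "if first = Dominator then KD {} {} else KS {} {}"
    and dominator: "\<And>A S x. \<lbrakk>KD A S; position H A S; x \<in> pverts H - (A \<union> S)\<rbrakk> \<Longrightarrow> KS (insert x A) S"
    and staller: "\<And>A S. \<lbrakk>KS A S; position H A S; \<not> pverts H \<subseteq> A \<union> S\<rbrakk>
      \<Longrightarrow> \<exists>x \<in> pverts H - (A \<union> S). KD A (insert x S)"
    and won: "\<And>A S. \<lbrakk>KD A S \<or> KS A S; position H A S; dominating_set H A\<rbrakk> \<Longrightarrow> B \<le> card A"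
  shows "enat B \<le> game_value first H"
proof -
  let ?A = "dom_part first" and ?S = "stal_part first"
  define K where "K h \<longleftrightarrow> (if dominator_turn first (length h) then KD (?A h) (?S h) else KS (?A h) (?S h))" for h
  have "\<exists>p \<in> {p \<in> complete_plays H. follows_strategy first \<sigma> p}. enat B \<le> moves_to_win first H p"
    if \<sigma>: "\<sigma> \<in> dominator_strategies first H" for \<sigma>
  proof -
    have "\<exists>h. length h = n \<and> distinct h \<and> set h \<subseteq> pverts H \<and> follows_strategy first \<sigma> h \<and>
        (\<forall>i \<le> n. K (take i h))" if "n \<le> card (pverts H)" for n
      using that
    proof (induction n)
      case 0
      have "K []" using init by (auto simp: K_def dominator_turn_0)
      then show ?case by (auto simp: follows_strategy_def)
    next
      case (Suc n)
      then obtain h where h: "length h = n" "distinct h" "set h \<subseteq> pverts H"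
        "follows_strategy first \<sigma> h" "\<forall>i \<le> n. K (take i h)" by auto
      have Kh: "K h" using h(1,5) by auto
      have ne: "set h \<noteq> pverts H" using Suc.prems h(1,2) distinct_card by fastforce
      have pos: "position H (?A h) (?S h)" by (rule position_parts[OF h(3)])
      have un: "?A h \<union> ?S h = set h" by (rule dom_part_Un_stal_part)
      have "\<exists>x \<in> pverts H - set h. K (h @ [x]) \<and> (dominator_turn first n \<longrightarrow> x = \<sigma> h)"
      proof (cases "dominator_turn first n")
        case True
        have x: "\<sigma> h \<in> pverts H - set h"
          using \<sigma> h True ne by (auto simp: dominator_strategies_def)
        have "KS (insert (\<sigma> h) (?A h)) (?S h)"
          using dominator[OF _ pos, of "\<sigma> h"] Kh True h(1) x un by (simp add: K_def)
        then have "K (h @ [\<sigma> h])"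
          using True h(1) x by (simp add: K_def dominator_turn_Suc dom_part_snoc_dominator)
        then show ?thesis using x by auto
      next
        case False
        obtain x where x: "x \<in> pverts H - set h" "KD (?A h) (insert x (?S h))"
          using staller[OF _ pos] Kh False h ne un by (auto simp: K_def)
        then have "K (h @ [x])"
          using False h(1) by (simp add: K_def dominator_turn_Suc dom_part_snoc_staller)
        then show ?thesis using x False by auto
      qed
      then obtain x where x: "x \<in> pverts H - set h" "K (h @ [x])"
        "dominator_turn first n \<longrightarrow> x = \<sigma> h" by auto
      show ?case
      proof (intro exI[of _ "h @ [x]"] conjI)
        show "follows_strategy first \<sigma> (h @ [x])"
          using h(1,4) x(3) by (auto simp: follows_strategy_def nth_append less_Suc_eq)
        show "\<forall>i \<le> Suc n. K (take i (h @ [x]))"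
          using h(1,5) x(2) by (auto simp: le_Suc_eq)
      qed (use h x in auto)
    qed
    from this[of "card (pverts H)"] obtain p where p: "length p = card (pverts H)" "distinct p"
      "set p \<subseteq> pverts H" "follows_strategy first \<sigma> p" "\<And>i. i \<le> length p \<Longrightarrow> K (take i p)"
      by auto
    have "set p = pverts H"
      using p fin by (metis card_subset_eq distinct_card)
    then have "p \<in> complete_plays H" using p by (simp add: complete_plays_def)
    moreover have "enat B \<le> moves_to_win first H p"
      unfolding moves_to_win_def
    proof (rule INF_greatest)
      fix n assume "n \<in> {n. n \<le> length p \<and> dominator_has_won first H (take n p)}"
      then have n: "n \<le> length p" "dominator_has_won first H (take n p)" by auto
      have sub: "set (take n p) \<subseteq> pverts H" using p(3) set_take_subset by fast
      have "K (take n p)" using n p by simp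
      then have "KD (?A (take n p)) (?S (take n p)) \<or> KS (?A (take n p)) (?S (take n p))"
        by (auto simp: K_def split: if_splits)
      then have "B \<le> card (?A (take n p))"
        using won[OF _ position_parts[OF sub]] n(2) dominator_has_won_iff[OF sub] by metis
      then show "enat B \<le> enat (length (dominator_moves first (take n p)))"
        using p(2) by (simp add: length_dominator_moves)
    qed
    ultimately show ?thesis using p(4) by blast
  qed
  then show ?thesis
    unfolding game_value_def by (intro INF_greatest) (metis (no_types, lifting) SUP_upper2)
qed

section \<open>Peeling off the pairs of a perfect matching of a forest\<close>

text \<open>A cycle is a path of distinct vertices with adjacent ends; three vertices are required
  because one edge traversed back and forth is not a cycle.\<close>

definition acyclic_rel :: "('c \<times> 'c) set \<Rightarrow> bool" where
  "acyclic_rel E \<longleftrightarrow>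
     (\<forall>p. distinct p \<and> 3 \<le> length p \<and> successively (\<lambda>a b. (a, b) \<in> E) p \<longrightarrow> (last p, hd p) \<notin> E)"

text \<open>A perfect matching on \<open>W\<close>, encoded as an involution so that it restricts to
  what remains when matched pairs are removed.\<close>

definition matching_fun :: "('c \<times> 'c) set \<Rightarrow> 'c set \<Rightarrow> ('c \<Rightarrow> 'c) \<Rightarrow> bool" where
  "matching_fun E W f \<longleftrightarrow> (\<forall>x \<in> W. f x \<in> W \<and> f (f x) = x \<and> (f x, x) \<in> E)"

section \<open>From trees and perfect matchings to acyclic relations and involutions\<close>

lemma cas_vwalk_arcs:
  "pre_digraph.cas (with_proj T) u (vwalk_arcs (u # vs)) (last (u # vs))"
  by (induction vs arbitrary: u) (auto simp: pre_digraph.cas.simps)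

lemma awalk_verts_vwalk_arcs:
  "pre_digraph.awalk_verts (with_proj T) u (vwalk_arcs (u # vs)) = u # vs"
  by (induction vs arbitrary: u) (auto simp: pre_digraph.awalk_verts.simps)

lemma set_vwalk_arcs_subset:
  "successively (\<lambda>a b. (a, b) \<in> E) vs \<Longrightarrow> set (vwalk_arcs vs) \<subseteq> E"
  by (induction vs rule: vwalk_arcs.induct) auto

text \<open>Returning to the first vertex of a path with adjacent ends gives a closed walk with as
  many arcs as the path has vertices, hence a cycle of length at least 3.\<close>

lemma is_tree_acyclic_rel:
  assumes "is_tree T"
  shows "acyclic_rel (parcs T)"
  unfolding acyclic_rel_def
proof (intro allI impI notI, elim conjE)
  fix p assume p: "distinct p" "3 \<le> length p" "successively (\<lambda>a b. (a, b) \<in> parcs T) p"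
    "(last p, hd p) \<in> parcs T"
  interpret pair_graph T using assms by (simp add: is_tree_def)
  obtain u vs where pu: "p = u # vs" using p(2) by (cases p) auto
  let ?q = "vwalk_arcs (u # (vs @ [u]))"
  have succ: "successively (\<lambda>a b. (a, b) \<in> parcs T) (u # (vs @ [u]))"
    using p(3,4) unfolding pu by (simp add: successively_append_iff flip: append_Cons)
  have "u \<in> pverts T" using p(4) pu in_arcsD2 by auto
  then have "pre_digraph.awalk (with_proj T) u ?q u"
    using set_vwalk_arcs_subset[OF succ] cas_vwalk_arcs[of T u "vs @ [u]"]
    by (simp add: pre_digraph.awalk_def)
  moreover have "distinct (tl (pre_digraph.awalk_verts (with_proj T) u ?q))"
    unfolding awalk_verts_vwalk_arcs using p(1) pu by simp
  moreover have len: "length ?q = length p"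
    using vwalk_length_simp[of "u # (vs @ [u])"] unfolding vwalk_length_def pu by (simp only: length_Cons length_append) simp
  ultimately have "pre_digraph.cycle (with_proj T) ?q"
    using p(2) by (auto simp: pre_digraph.cycle_def)
  with assms len p(2) show False by (auto simp: is_tree_def)
qed

text \<open>The edges \<open>{x, f x}\<close> and \<open>{f x, f (f x)}\<close> of the matching
  share \<open>f x\<close>, so disjointness makes them equal.\<close>

lemma perfect_matching_matching_fun:
  assumes "pair_graph G" "perfect_matching G M"
  obtains f where "matching_fun (parcs G) (pverts G) f"
proof -
  interpret pair_graph G by fact
  have "\<exists>y. y \<in> pverts G \<and> (y, x) \<in> parcs G \<and> {x, y} \<in> M" if x: "x \<in> pverts G" for x
  proof -
    obtain e where e: "e \<in> M" "x \<in> e" using assms(2) x by (auto simp: perfect_matching_def)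
    then obtain u v where uv: "e = {u, v}" "(u, v) \<in> parcs G"
      using assms(2) by (auto simp: perfect_matching_def edges_def)
    have "(v, u) \<in> parcs G" using uv(2) pair_sym_arcs by (auto simp: sym_def symmetric_def)
    moreover have "u \<in> pverts G" "v \<in> pverts G" using uv(2) in_arcsD1 in_arcsD2 by auto
    moreover have "x = u \<or> x = v" "{u, v} \<in> M" "{v, u} \<in> M" using e uv(1) by (auto simp: insert_commute)
    ultimately show ?thesis using uv(2) by blast
  qed
  then obtain f where f: "\<And>x. x \<in> pverts G \<Longrightarrow> f x \<in> pverts G \<and> (f x, x) \<in> parcs G \<and> {x, f x} \<in> M"
    by metis
  have "f (f x) = x" if x: "x \<in> pverts G" for x
  proof -
    have "{x, f x} \<in> M" "{f x, f (f x)} \<in> M" using f x by auto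
    moreover have "pairwise disjnt M" using assms(2) by (simp add: perfect_matching_def)
    moreover have "\<not> disjnt {x, f x} {f x, f (f x)}" by (simp add: disjnt_def)
    ultimately have "{x, f x} = {f x, f (f x)}" by (metis pairwiseD)
    then have "x \<in> {f x, f (f x)}" by blast
    moreover have "x \<noteq> f x" using f[OF x] pair_no_loops by fastforce
    ultimately show ?thesis by simp
  qed
  then have "matching_fun (parcs G) (pverts G) f" using f by (auto simp: matching_fun_def)
  then show thesis by (rule that)
qed

section \<open>Longest paths in a forest and the leaves at their ends\<close>

text \<open>A neighbour of the head off the path would prolong it, one at index 2 or more would
  close a cycle, and index 0 would be a loop.\<close>

lemma longest_path_hd_neighbour:
  assumes E: "sym E" "irrefl E" "acyclic_rel E"
    and p: "p \<noteq> []" "distinct p" "set p \<subseteq> W" "successively (\<lambda>a b. (a, b) \<in> E) p"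
    and longest: "\<And>q. \<lbrakk>distinct q; set q \<subseteq> W; successively (\<lambda>a b. (a, b) \<in> E) q\<rbrakk> \<Longrightarrow> length q \<le> length p"
    and b: "b \<in> W" "(b, hd p) \<in> E"
  shows "length p \<ge> 2 \<and> b = p ! 1"
proof -
  have "b \<in> set p"
  proof (rule ccontr)
    assume "b \<notin> set p"
    then have "length (b # p) \<le> length p"
      using p b by (intro longest) (auto simp: successively_Cons)
    then show False by simp
  qed
  then obtain j where j: "j < length p" "b = p ! j" by (metis in_set_conv_nth)
  have "j \<noteq> 0" using j b(2) E(2) p(1) by (metis hd_conv_nth irrefl_def)
  moreover have "\<not> 2 \<le> j"
  proof
    assume "2 \<le> j"
    let ?c = "take (Suc j) p"
    have "successively (\<lambda>a b. (a, b) \<in> E) (?c @ drop (Suc j) p)" using p(4) by simp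
    then have "successively (\<lambda>a b. (a, b) \<in> E) ?c" unfolding successively_append_iff by blast
    moreover have "last ?c = b" using j by (simp add: take_Suc_conv_app_nth)
    moreover have "hd ?c = hd p" using p(1) by simp
    ultimately have "(b, hd p) \<notin> E"
      using E(3) p(2) \<open>2 \<le> j\<close> j(1) unfolding acyclic_rel_def
      by (metis Suc_le_eq distinct_take eval_nat_numeral(3) length_take min.absorb2 not_less_eq_eq)
    with b(2) show False by simp
  qed
  ultimately have "j = 1" by simp
  with j show ?thesis by auto
qed

text \<open>Both ends of a longest path are leaves matched with their neighbours on it. If z meets
  both end pairs, the path is a single pair, and then \<open>[c, f c]\<close>, which avoids z, is a
  longest path too.\<close>

lemma ex_matched_leaf:
  assumes E: "sym E" "irrefl E" "acyclic_rel E"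
    and W: "finite W" "matching_fun E W f" and c: "c \<in> W - {z, f z}"
  obtains x where "x \<in> W" "x \<noteq> z" "f x \<noteq> z" "\<And>w. \<lbrakk>w \<in> W; (w, x) \<in> E\<rbrakk> \<Longrightarrow> w = f x"
proof -
  note found = that
  let ?path = "\<lambda>p. distinct p \<and> set p \<subseteq> W \<and> successively (\<lambda>a b. (a, b) \<in> E) p"
  have f: "f x \<in> W" "f (f x) = x" "(f x, x) \<in> E" "(x, f x) \<in> E" "f x \<noteq> x" if "x \<in> W" for x
    using that W(2) E(1,2) unfolding matching_fun_def sym_def irrefl_def by metis+
  have c': "?path [c, f c]" using c f[of c] by auto
  have bound: "length p \<le> card W" if "?path p" for p
    using that W(1) by (metis card_mono distinct_card)
  define p where "p = arg_max length ?path"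
  have p: "?path p" and longest: "\<And>q. ?path q \<Longrightarrow> length q \<le> length p"
    using arg_max_nat_lemma[where P = ?path and f = length and b = "Suc (card W)", OF c'] bound
    unfolding p_def by (auto simp: less_Suc_eq_le)
  have len: "2 \<le> length p" using longest[OF c'] by simp
  have leaf: "w = f (hd q)" "q ! 1 = f (hd q)"
    if q: "?path q" "length q = length p" and w: "w \<in> W" "(w, hd q) \<in> E" for q w
  proof -
    have "q \<noteq> []" using q(2) len by auto
    then have hd: "hd q \<in> W" using q(1) hd_in_set by blast
    have nb: "b = q ! 1" if "b \<in> W" "(b, hd q) \<in> E" for b
      using longest_path_hd_neighbour[OF E \<open>q \<noteq> []\<close> _ _ _ _ that] q longest by metis
    show "w = f (hd q)" "q ! 1 = f (hd q)" using nb[OF w] nb[of "f (hd q)"] f[OF hd] by auto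
  qed
  have take_leaf: thesis if q: "?path q" "length q = length p" and z: "z \<noteq> hd q" "z \<noteq> f (hd q)" for q
  proof -
    have "hd q \<in> W" using q len by (metis hd_in_set length_0_conv not_numeral_le_zero subsetD)
    then show thesis using found[of "hd q"] leaf[OF q] z by blast
  qed
  \<comment> \<open>Reversal turns the last vertex into a head, so that \<open>leaf\<close> covers
    it as well.\<close>
  have "successively (\<lambda>a b. (b, a) \<in> E) p"
    by (rule successively_mono[where P = "\<lambda>a b. (a, b) \<in> E"]) (use p E(1) in \<open>auto simp: sym_def\<close>)
  then have rev: "?path (rev p)" using p by simp
  have pne: "p \<noteq> []" using len by auto
  have W': "hd p \<in> W" "last p \<in> W" using p pne by auto
  show thesis
  proof (cases "z \<in> {hd p, f (hd p)} \<and> z \<in> {last p, f (last p)}")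
    case False
    then show thesis using take_leaf[OF p] take_leaf[OF rev] pne by (auto simp: hd_rev)
  next
    case True
    have "hd p \<noteq> last p"
      using p len by (auto simp: hd_conv_nth last_conv_nth pne nth_eq_iff_index_eq)
    with True have "last p = f (hd p)" using f W' by (metis insertE singletonD)
    moreover have "p ! 1 = f (hd p)" using leaf(2)[OF p refl] f(1,3) W' by blast
    ultimately have "p ! (length p - 1) = p ! 1" by (simp add: last_conv_nth pne)
    then have "length p - 1 = 1"
      using p len nth_eq_iff_index_eq[of p "length p - 1" 1] by simp
    then have "length [c, f c] = length p" using len by simp
    from take_leaf[OF c' this] c f show thesis
      by (metis Diff_iff insert_iff list.sel(1))
  qed
qed

text \<open>
  Each pair (x, y) of the list consists of a leaf x and its neighbour y in the graph that remains
  after the removal of \<open>S\<close> and of the preceding pairs.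
\<close>

fun peels :: "('c \<Rightarrow> 'c set) \<Rightarrow> 'c set \<Rightarrow> ('c \<times> 'c) list \<Rightarrow> bool" where
  "peels N S [] \<longleftrightarrow> True"
| "peels N S ((x, y) # ps) \<longleftrightarrow> N x \<subseteq> insert y S \<and> peels N (insert y S) ps"

abbreviation pair_verts :: "('c \<times> 'c) list \<Rightarrow> 'c list" where
  "pair_verts ps \<equiv> map fst ps @ map snd ps"

lemma peels_mono: "peels N S ps \<Longrightarrow> S \<subseteq> S' \<Longrightarrow> peels N S' ps"
proof (induction ps arbitrary: S S')
  case (Cons a ps)
  obtain x y where "a = (x, y)" by fastforce
  then show ?case using Cons.IH[of "insert y S" "insert y S'"] Cons.prems by auto
qed simp

lemma peels_append: "peels N S ps \<Longrightarrow> peels N S qs \<Longrightarrow> peels N S (ps @ qs)"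
proof (induction ps arbitrary: S)
  case (Cons a ps)
  obtain x y where "a = (x, y)" by fastforce
  then show ?case using Cons.IH[of "insert y S"] Cons.prems peels_mono[of N S qs "insert y S"] by auto
qed simp

text \<open>When x is peeled off, its neighbours lie among y, \<open>S\<close> and the second
  components of earlier pairs.\<close>

lemma peels_neighbours: "peels N S ps \<Longrightarrow> x \<in> fst ` set ps \<Longrightarrow> N x \<subseteq> S \<union> snd ` set ps"
  by (induction N S ps rule: peels.induct) auto

text \<open>Induction on \<open>card W\<close>: a matched leaf whose pair avoids z is put in front,
  until only z and its partner are left. This last pair is the 2 in the count.\<close>

lemma ex_peels:
  assumes E: "sym E" "irrefl E" "acyclic_rel E"
    and W: "finite W" "matching_fun E W f" "z \<in> W"
    and S: "W \<inter> S = {}" "\<And>w. w \<in> W \<Longrightarrow> {v. (v, w) \<in> E} \<subseteq> W \<union> S"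
  shows "\<exists>ps. peels (\<lambda>w. {v. (v, w) \<in> E}) S ps \<and> distinct (pair_verts ps) \<and>
    set (pair_verts ps) \<subseteq> W - {z} \<and> card W = 2 * length ps + 2"
  using W S
proof (induction "card W" arbitrary: W S rule: less_induct)
  case less
  note W = less.prems(1,2,3)
  have f: "f x \<in> W" "f (f x) = x" "(f x, x) \<in> E" "(x, f x) \<in> E" "f x \<noteq> x" if "x \<in> W" for x
    using that W(2) E(1,2) unfolding matching_fun_def sym_def irrefl_def by metis+
  show ?case
  proof (cases "W = {z, f z}")
    case True
    then show ?thesis using f[OF W(3)] by (intro exI[of _ "[]"]) (simp add: card_insert_if)
  next
    case False
    then obtain c where "c \<in> W - {z, f z}" using f W by blast
    with ex_matched_leaf[OF E W(1,2)] obtain x where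
      x: "x \<in> W" "x \<noteq> z" "f x \<noteq> z" "\<And>w. \<lbrakk>w \<in> W; (w, x) \<in> E\<rbrakk> \<Longrightarrow> w = f x" by metis
    let ?W = "W - {x, f x}" and ?S = "insert (f x) S"
    have card: "card W = card ?W + 2"
      using card_mono[OF W(1), of "{x, f x}"] card_Diff_subset[of "{x, f x}" W] x(1) f[OF x(1)]
      by (simp add: card_insert_if)
    have "matching_fun E ?W f" using f x(1) unfolding matching_fun_def by (metis Diff_iff insert_iff singletonD)
    moreover have "{v. (v, w) \<in> E} \<subseteq> ?W \<union> ?S" if w: "w \<in> ?W" for w
    proof -
      \<comment> \<open>Only \<open>f x\<close> has to enter \<open>S\<close>: the leaf x is
        adjacent to no vertex that remains.\<close>
      have "(x, w) \<notin> E" using w x(4)[of w] E(1) by (auto simp: sym_def)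
      then show ?thesis using less.prems(5)[of w] w by auto
    qed
    ultimately have "\<exists>ps. peels (\<lambda>w. {v. (v, w) \<in> E}) ?S ps \<and> distinct (pair_verts ps) \<and>
      set (pair_verts ps) \<subseteq> ?W - {z} \<and> card ?W = 2 * length ps + 2"
      using card W x less.prems(4) by (intro less.hyps) auto
    then obtain ps where ps: "peels (\<lambda>w. {v. (v, w) \<in> E}) ?S ps" "distinct (pair_verts ps)"
      "set (pair_verts ps) \<subseteq> ?W - {z}" "card ?W = 2 * length ps + 2" by blast
    have "{v. (v, x) \<in> E} \<subseteq> ?S" using less.prems(5)[OF x(1)] x(4) by blast
    then have "peels (\<lambda>w. {v. (v, w) \<in> E}) S ((x, f x) # ps)" using ps(1) by simp
    moreover have "distinct (pair_verts ((x, f x) # ps))"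
      using ps(2,3) f[OF x(1)] by auto
    moreover have "set (pair_verts ((x, f x) # ps)) \<subseteq> W - {z}"
      using ps(3) x f by auto
    moreover have "card W = 2 * length ((x, f x) # ps) + 2"
      using ps(4) card by (metis add.commute length_Cons mult_Suc_right)
    ultimately show ?thesis by blast
  qed
qed

section \<open>Domination in a corona\<close>

definition hubs :: "('a + 'a \<times> 'b) set \<Rightarrow> 'a set" where
  "hubs A = {u. Inl u \<in> A}"

definition branch :: "('a + 'a \<times> 'b) set \<Rightarrow> 'a \<Rightarrow> 'b set" where
  "branch A u = {x. Inr (u, x) \<in> A}"

lemma hubs_insert [simp]:
  "hubs (insert (Inl u) A) = insert u (hubs A)" "hubs (insert (Inr p) A) = hubs A"
  by (auto simp: hubs_def)

lemma branch_insert [simp]: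
  "branch (insert (Inl u) A) v = branch A v"
  "branch (insert (Inr (u, x)) A) v = (if v = u then insert x (branch A v) else branch A v)"
  by (auto simp: branch_def)

lemma hubs_branch_empty [simp]: "hubs {} = {}" "branch {} u = {}"
  by (simp_all add: hubs_def branch_def)

lemma pverts_corona: "pverts (G \<odot> H) = Inl ` pverts G \<union> Inr ` (pverts G \<times> pverts H)"
  by (simp add: corona_def)

lemma parcs_corona_branch:
  assumes "u \<in> pverts G"
  shows "(w, Inr (u, x)) \<in> parcs (G \<odot> H) \<longleftrightarrow>
    (\<exists>y. w = Inr (u, y) \<and> (y, x) \<in> parcs H) \<or> (w = Inl u \<and> x \<in> pverts H)"
  using assms by (auto simp: corona_def)

text \<open>The setting of Dominator's strategy, with the matching given by \<open>f\<close>.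
  Acyclicity is added in \<open>tree_corona\<close> for Staller.\<close>

locale matched_corona =
  fixes G :: "'a pair_pre_digraph" and T :: "'b pair_pre_digraph" and f :: "'b \<Rightarrow> 'b"
  assumes G: "pair_graph G" and T: "pair_graph T" and T_nonempty: "pverts T \<noteq> {}"
    and G_large: "graph_order G \<ge> 2"
    and matching: "matching_fun (parcs T) (pverts T) f"
begin

abbreviation "H \<equiv> G \<odot> T"
abbreviation "n \<equiv> graph_order G"
abbreviation "m \<equiv> graph_order T div 2"

lemma finite_G: "finite (pverts G)"
proof -
  interpret pair_graph G by (rule G)
  show ?thesis by (rule pair_finite_verts)
qed

lemma finite_T: "finite (pverts T)"
  and T_sym: "sym (parcs T)"
  and T_irrefl: "irrefl (parcs T)"
  and T_arcs: "(x, y) \<in> parcs T \<Longrightarrow> x \<in> pverts T \<and> y \<in> pverts T"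
proof -
  interpret pair_graph T by (rule T)
  show "finite (pverts T)" by (rule pair_finite_verts)
  show "sym (parcs T)" using pair_sym_arcs by (auto simp: symmetric_def)
  show "irrefl (parcs T)" using pair_no_loops by (fastforce simp: irrefl_def)
  show "(x, y) \<in> parcs T \<Longrightarrow> x \<in> pverts T \<and> y \<in> pverts T"
    using in_arcsD1 in_arcsD2 by blast
qed

lemma finite_H: "finite (pverts H)"
  by (simp add: pverts_corona finite_G finite_T)

lemma mate: "f x \<in> pverts T" "f (f x) = x" "(f x, x) \<in> parcs T" "f x \<noteq> x" if "x \<in> pverts T"
  using that matching T_irrefl unfolding matching_fun_def irrefl_def by metis+

lemma hubs_branch_subset:
  assumes "A \<subseteq> pverts H"
  shows "hubs A \<subseteq> pverts G" "branch A u \<subseteq> pverts T" "u \<notin> pverts G \<Longrightarrow> branch A u = {}"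
  using assms by (auto simp: hubs_def branch_def pverts_corona)

lemma finite_hubs_branch:
  assumes "A \<subseteq> pverts H"
  shows "finite (hubs A)" "finite (branch A u)"
  using hubs_branch_subset[OF assms] finite_G finite_T by (meson finite_subset)+

lemma card_corona_set:
  assumes "A \<subseteq> pverts H"
  shows "card A = card (hubs A) + (\<Sum>u \<in> pverts G. card (branch A u))"
proof -
  have A: "A = Inl ` hubs A \<union> Inr ` (SIGMA u : pverts G. branch A u)"
    using assms by (auto simp: hubs_def branch_def pverts_corona)
  have fin: "finite (SIGMA u : pverts G. branch A u)"
    using finite_G finite_hubs_branch[OF assms] by auto
  have "card A = card (Inl ` hubs A :: ('a + 'a \<times> 'b) set) +
      card (Inr ` (SIGMA u : pverts G. branch A u) :: ('a + 'a \<times> 'b) set)"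
    by (subst A, subst card_Un_disjoint) (use fin finite_hubs_branch[OF assms] in auto)
  then show ?thesis
    using finite_G finite_hubs_branch[OF assms] by (simp add: card_image)
qed

text \<open>A branch vertex has all its neighbours in its branch and its hub, so branches can be
  treated separately. A branch dominated from within contains a selected vertex, which also
  dominates the hub.\<close>

lemma dominating_set_corona:
  assumes A: "A \<subseteq> pverts H"
  shows "dominating_set H A \<longleftrightarrow> (\<forall>u \<in> pverts G. u \<in> hubs A \<or> dominating_set T (branch A u))"
    (is "?l \<longleftrightarrow> ?r")
proof
  assume l: ?l
  show ?r
  proof (intro ballI)
    fix u assume u: "u \<in> pverts G"
    have "x \<in> branch A u \<or> (\<exists>y \<in> branch A u. (y, x) \<in> parcs T)" if "u \<notin> hubs A" "x \<in> pverts T" for x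
    proof -
      have "Inr (u, x) \<in> A \<or> (\<exists>w \<in> A. (w, Inr (u, x)) \<in> parcs H)"
        using l u that(2) by (auto simp: dominating_set_def pverts_corona)
      then show ?thesis
        using that by (auto simp: parcs_corona_branch[OF u] branch_def hubs_def)
    qed
    then show "u \<in> hubs A \<or> dominating_set T (branch A u)"
      using hubs_branch_subset[OF A] by (auto simp: dominating_set_def)
  qed
next
  assume r: ?r
  have "v \<in> A \<or> (\<exists>w \<in> A. (w, v) \<in> parcs H)" if "v \<in> pverts H" for v
  proof (cases v)
    case (Inl u)
    with that have u: "u \<in> pverts G" by (auto simp: pverts_corona)
    show ?thesis
    proof (cases "u \<in> hubs A")
      case True
      then show ?thesis using Inl by (simp add: hubs_def)
    next
      case False
      with r u have "dominating_set T (branch A u)" by blast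
      then obtain x where "x \<in> branch A u" using T_nonempty by (auto simp: dominating_set_def)
      moreover have "x \<in> pverts T" using calculation hubs_branch_subset[OF A] by blast
      ultimately have "Inr (u, x) \<in> A" "(Inr (u, x), Inl u) \<in> parcs H"
        using u by (auto simp: branch_def corona_def)
      then show ?thesis using Inl by blast
    qed
  next
    case (Inr p)
    then obtain u x where v: "v = Inr (u, x)" by (cases p) auto
    with that have ux: "u \<in> pverts G" "x \<in> pverts T" by (auto simp: pverts_corona)
    show ?thesis
    proof (cases "u \<in> hubs A")
      case True
      then show ?thesis using v ux by (auto simp: hubs_def parcs_corona_branch)
    next
      case False
      with r ux have "dominating_set T (branch A u)" by blast
      then show ?thesis using v ux
        by (auto simp: dominating_set_def branch_def parcs_corona_branch)
    qed
  qed
  then show ?l using A by (simp add: dominating_set_def)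
qed

lemma not_dominating_set_empty: "\<not> dominating_set T {}"
  using T_nonempty by (auto simp: dominating_set_def)

lemma dominating_set_transversal:
  assumes "B \<subseteq> pverts T" "\<And>x. x \<in> pverts T \<Longrightarrow> x \<in> B \<or> f x \<in> B"
  shows "dominating_set T B"
  using assms mate(3) unfolding dominating_set_def by blast

text \<open>\<open>B\<close> and its image under \<open>f\<close> are disjoint sets of equal size
  inside T.\<close>

lemma card_partial_transversal:
  assumes B: "B \<subseteq> pverts T" "\<And>x. x \<in> B \<Longrightarrow> f x \<notin> B"
  shows "card B \<le> m"
proof -
  have "inj_on f B" using B(1) mate(2) by (metis inj_on_def subsetD)
  then have "2 * card B = card (B \<union> f ` B)"
    using B finite_subset[OF B(1) finite_T] by (subst card_Un_disjoint) (auto simp: card_image)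
  also have "\<dots> \<le> card (pverts T)"
    using B mate(1) by (intro card_mono finite_T) auto
  finally show ?thesis by linarith
qed

lemma m_pos: "1 \<le> m"
proof -
  obtain x where "x \<in> pverts T" using T_nonempty by blast
  then have "card {x} \<le> m" using mate by (intro card_partial_transversal) auto
  then show ?thesis by simp
qed

section \<open>Dominator's strategy\<close>

text \<open>
  The invariant of Dominator's strategy, with \<open>k = 1\<close> if he is to move and \<open>k = 0\<close> otherwise. The
  first conjunct says that he ends up with at least \<open>c\<close> hubs if the free hubs are from now on
  selected alternately. The second and third ones bound the number of his moves: he selects
  nothing in a branch whose hub he may still get, and never both vertices of a matched pair.
\<close>

definition safe :: "nat \<Rightarrow> nat \<Rightarrow> ('a + 'a \<times> 'b) set \<Rightarrow> ('a + 'a \<times> 'b) set \<Rightarrow> bool" where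
  "safe c k A S \<longleftrightarrow>
     c \<le> card (hubs A) + (card (pverts G - hubs A - hubs S) + k) div 2 \<and>
     (\<forall>u. branch A u \<noteq> {} \<longrightarrow> u \<in> hubs S) \<and>
     (\<forall>u. \<forall>x \<in> branch A u. f x \<notin> branch A u) \<and>
     (\<forall>u. u \<notin> hubs A \<longrightarrow> (\<forall>x \<in> branch S u. u \<in> hubs S \<and> f x \<in> branch A u))"

lemma safeD:
  assumes "safe c k A S"
  shows "c \<le> card (hubs A) + (card (pverts G - hubs A - hubs S) + k) div 2"
    "\<And>u x. x \<in> branch A u \<Longrightarrow> u \<in> hubs S"
    "\<And>u x. x \<in> branch A u \<Longrightarrow> f x \<notin> branch A u"
    "\<And>u x. u \<notin> hubs A \<Longrightarrow> x \<in> branch S u \<Longrightarrow> u \<in> hubs S \<and> f x \<in> branch A u"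
  using assms unfolding safe_def by blast+

text \<open>With F free hubs, F at least 1, \<open>1 + (F - 1) div 2\<close> equals
  \<open>(F + 1) div 2\<close>: taking a hub uses up exactly the advantage of being to move.\<close>

lemma safe_hub:
  assumes "u \<in> pverts G - hubs A - hubs S"
    and "c \<le> card (hubs A) + (card (pverts G - hubs A - hubs S) + 1) div 2" "A \<subseteq> pverts H"
  shows "c \<le> card (hubs (insert (Inl u) A)) + card (pverts G - hubs (insert (Inl u) A) - hubs S) div 2"
proof -
  have "pverts G - hubs (insert (Inl u) A) - hubs S = (pverts G - hubs A - hubs S) - {u}" by auto
  moreover have "card (pverts G - hubs A - hubs S) = Suc (card ((pverts G - hubs A - hubs S) - {u}))"
    using assms(1) finite_G by (intro card.remove) auto
  moreover have "card (hubs (insert (Inl u) A)) = Suc (card (hubs A))"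
    using assms(1) finite_hubs_branch[OF assms(3)] by simp
  ultimately show ?thesis using assms(2) by simp
qed

text \<open>A free hub is taken while there is one. Afterwards an undominated branch has a matched
  pair without a vertex of Dominator, and by the last conjunct of \<open>safe\<close> Staller has
  none in it either.\<close>

lemma safe_dominator_move:
  assumes s: "safe c 1 A S" and pos: "position H A S" and nd: "\<not> dominating_set H A"
  shows "\<exists>v \<in> pverts H - (A \<union> S). safe c 0 (insert v A) S"
proof -
  have A: "A \<subseteq> pverts H" and S: "S \<subseteq> pverts H" and AS: "A \<inter> S = {}"
    using pos by (auto simp: position_def)
  show ?thesis
  proof (cases "pverts G - hubs A - hubs S = {}")
    case False
    then obtain u where u: "u \<in> pverts G - hubs A - hubs S" by blast
    then have "safe c 0 (insert (Inl u) A) S"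
      using safe_hub[OF u safeD(1)[OF s] A] s unfolding safe_def by simp
    moreover have "Inl u \<in> pverts H - (A \<union> S)" using u by (auto simp: hubs_def pverts_corona)
    ultimately show ?thesis by blast
  next
    case True
    obtain u where u: "u \<in> pverts G" "u \<notin> hubs A" "\<not> dominating_set T (branch A u)"
      using nd dominating_set_corona[OF A] by blast
    then obtain x where x: "x \<in> pverts T" "x \<notin> branch A u" "f x \<notin> branch A u"
      using dominating_set_transversal hubs_branch_subset[OF A] by metis
    have uS: "u \<in> hubs S" using u True by blast
    have "x \<notin> branch S u" using safeD(4)[OF s u(2)] x by blast
    then have "Inr (u, x) \<in> pverts H - (A \<union> S)" using u x by (auto simp: branch_def pverts_corona)
    moreover have "safe c 0 (insert (Inr (u, x)) A) S"
      unfolding safe_def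
    proof (intro conjI)
      show "c \<le> card (hubs (insert (Inr (u, x)) A)) +
          (card (pverts G - hubs (insert (Inr (u, x)) A) - hubs S) + 0) div 2"
        using safeD(1)[OF s] unfolding hubs_insert True by simp
      show "\<forall>v. \<forall>y\<in>branch (insert (Inr (u, x)) A) v. f y \<notin> branch (insert (Inr (u, x)) A) v"
        using safeD(3)[OF s] x mate hubs_branch_subset[OF A] by (auto split: if_splits) (metis subsetD)
    qed (use safeD[OF s] uS in \<open>auto split: if_splits\<close>)
    ultimately show ?thesis by blast
  qed
qed

text \<open>A hub, or a branch vertex that does no harm, leaves Dominator his move. A vertex in the
  branch of a free hub is answered by that hub, any other by its partner.\<close>

lemma safe_staller_move:
  assumes s: "safe c 0 A S" and pos: "position H A S" and v: "v \<in> pverts H - (A \<union> S)"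
  shows "safe c 1 A (insert v S) \<or> (\<exists>w \<in> pverts H - (A \<union> insert v S). safe c 0 (insert w A) (insert v S))"
proof -
  have A: "A \<subseteq> pverts H" and S: "S \<subseteq> pverts H" and AS: "A \<inter> S = {}"
    using pos by (auto simp: position_def)
  note s = safeD[OF s]
  let ?F = "pverts G - hubs A - hubs S"
  show ?thesis
  proof (cases v)
    case (Inl u)
    with v have u: "u \<in> ?F" by (auto simp: hubs_def pverts_corona)
    have "pverts G - hubs A - hubs (insert (Inl u) S) = ?F - {u}" by auto
    moreover have "card ?F = Suc (card (?F - {u}))"
      using u finite_G by (intro card.remove) auto
    \<comment> \<open>One free hub fewer is offset by \<open>k\<close> rising from 0 to 1.\<close>
    ultimately have "safe c 1 A (insert v S)"
      unfolding Inl safe_def using s by auto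
    then show ?thesis ..
  next
    case (Inr p)
    then obtain u x where vux: "v = Inr (u, x)" by (cases p) auto
    with v have u: "u \<in> pverts G" and x: "x \<in> pverts T" "x \<notin> branch A u" "x \<notin> branch S u"
      by (auto simp: pverts_corona branch_def)
    show ?thesis
    proof (cases "u \<in> hubs A \<or> (u \<in> hubs S \<and> f x \<in> branch A u)")
      case True
      then have "safe c 1 A (insert v S)"
        unfolding vux safe_def using s by auto
      then show ?thesis ..
    next
      case nA: False
      show ?thesis
      proof (cases "u \<in> hubs S")
        case False
        with nA u have uF: "u \<in> ?F" by blast
        have "c \<le> card (hubs A) + (card (pverts G - hubs A - hubs (insert v S)) + 1) div 2"
          using s(1) vux by simp
        then have "safe c 0 (insert (Inl u) A) (insert v S)"
          using safe_hub[of u A "insert v S"] uF A s(2-) unfolding safe_def vux by auto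
        moreover have "Inl u \<in> pverts H - (A \<union> insert v S)"
          using uF vux by (auto simp: hubs_def pverts_corona)
        ultimately show ?thesis by blast
      next
        case True
        with nA have fx: "f x \<notin> branch A u" "u \<notin> hubs A" by auto
        \<comment> \<open>If Staller owned \<open>f x\<close>, its partner x would already be
          Dominator's.\<close>
        have "f x \<notin> branch S u" using s(4)[OF fx(2), of "f x"] mate[OF x(1)] x by auto
        then have free: "Inr (u, f x) \<in> pverts H - (A \<union> insert v S)"
          using u x fx mate[OF x(1)] vux by (auto simp: branch_def pverts_corona)
        have ne: "f y \<noteq> f x" if "y \<in> branch A u" for y
          using that x mate hubs_branch_subset(2)[OF A] by (metis subsetD)
        have "safe c 0 (insert (Inr (u, f x)) A) (insert v S)"
          unfolding safe_def
        proof (intro conjI)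
          show "\<forall>w. \<forall>y\<in>branch (insert (Inr (u, f x)) A) w. f y \<notin> branch (insert (Inr (u, f x)) A) w"
            using s(3) mate[OF x(1)] ne by (auto split: if_splits)
        qed (use s True vux in \<open>auto split: if_splits\<close>)
        with free show ?thesis by blast
      qed
    qed
  qed
qed

text \<open>Domination settles every hub, as the branch of a free hub is empty. In each branch of
  Staller's hubs Dominator has at most one vertex per pair, and a hub beyond his share
  \<open>c\<close> costs no more than the branch it replaces.\<close>

lemma safe_won:
  assumes s: "safe c 0 A S" and pos: "position H A S" and dom: "dominating_set H A" and c: "c \<le> n"
  shows "card A \<le> c + (n - c) * m"
proof -
  have A: "A \<subseteq> pverts H" and S: "S \<subseteq> pverts H" and AS: "A \<inter> S = {}"
    using pos by (auto simp: position_def)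
  have "u \<in> hubs A \<or> u \<in> hubs S" if "u \<in> pverts G" for u
    using that dom safeD(2)[OF s, of _ u] not_dominating_set_empty dominating_set_corona[OF A]
    by (metis equals0I)
  then have F: "pverts G - hubs A - hubs S = {}" by blast
  have disj: "hubs A \<inter> hubs S = {}" using AS by (auto simp: hubs_def)
  have un: "hubs A \<union> hubs S = pverts G"
    using F hubs_branch_subset[OF A] hubs_branch_subset[OF S] by blast
  have n: "card (hubs A) + card (hubs S) = n"
    using card_Un_disjoint[OF finite_hubs_branch(1)[OF A] finite_hubs_branch(1)[OF S] disj] un by simp
  have c': "c \<le> card (hubs A)" using safeD(1)[OF s] F by simp
  have "(\<Sum>u \<in> pverts G. card (branch A u)) = (\<Sum>u \<in> hubs S. card (branch A u))"
    using finite_G safeD(2)[OF s] hubs_branch_subset(1)[OF S] finite_hubs_branch[OF A]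
    by (intro sum.mono_neutral_right) auto
  also have "\<dots> \<le> (\<Sum>u \<in> hubs S. m)"
    using safeD(3)[OF s] hubs_branch_subset[OF A] by (intro sum_mono card_partial_transversal) auto
  finally have "card A \<le> card (hubs A) + card (hubs S) * m"
    using card_corona_set[OF A] by simp
  also have "\<dots> \<le> c + (n - c) * m"
  proof -
    obtain j where j: "card (hubs A) = c + j" using c' le_Suc_ex by blast
    then have "n - c = card (hubs S) + j" using n by simp
    moreover have "j \<le> j * m" using m_pos by simp
    ultimately show ?thesis using j by (simp add: algebra_simps)
  qed
  finally show ?thesis .
qed

text \<open>In a branch whose hub is not Dominator's, every vertex is his or Staller's, and in the
  latter case the last conjunct of \<open>safe\<close> gives him its partner.\<close>

lemma safe_full:
  assumes s: "safe c 0 A S" and pos: "position H A S" and full: "pverts H \<subseteq> A \<union> S"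
  shows "dominating_set H A"
proof -
  have A: "A \<subseteq> pverts H" using pos by (auto simp: position_def)
  have "dominating_set T (branch A u)" if u: "u \<in> pverts G" "u \<notin> hubs A" for u
  proof (rule dominating_set_transversal[OF hubs_branch_subset(2)[OF A]])
    fix x assume "x \<in> pverts T"
    then have "Inr (u, x) \<in> A \<union> S" using u full by (auto simp: pverts_corona)
    then show "x \<in> branch A u \<or> f x \<in> branch A u"
      using safeD(4)[OF s u(2)] by (auto simp: branch_def)
  qed
  then show ?thesis using dominating_set_corona[OF A] by blast
qed

text \<open>\<open>(n + d) div 2\<close> is Dominator's share of the hubs under alternate selection,
  rounded up when he starts.\<close>

lemma game_value_corona_le:
  fixes first :: player
  defines "d \<equiv> (if first = Dominator then 1 else 0)"
  shows "game_value first H \<le> enat ((n + d) div 2 + (n - (n + d) div 2) * m)"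
proof -
  let ?c = "(n + d) div 2"
  have c: "?c \<le> n" using G_large unfolding d_def by (cases "first = Dominator") simp_all
  have start: "safe ?c d {} {}" by (simp add: safe_def)
  show ?thesis
  \<comment> \<open>The second alternative of \<open>QD\<close> stores the reply that
    \<open>safe_staller_move\<close> provides.\<close>
  proof (rule game_value_leI[where QS = "safe ?c 0" and
        QD = "\<lambda>A S. safe ?c 1 A S \<or> (\<exists>v \<in> pverts H - (A \<union> S). safe ?c 0 (insert v A) S)"])
    show "if first = Dominator
      then safe ?c 1 {} {} \<or> (\<exists>v \<in> pverts H - ({} \<union> {}). safe ?c 0 (insert v {}) {})
      else safe ?c 0 {} {}"
      using start unfolding d_def by (cases "first = Dominator") simp_all
  qed (use safe_staller_move safe_dominator_move safe_won[OF _ _ _ c] safe_full in blast)+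
qed

end

section \<open>Staller's strategy\<close>

lemma distinct_pair_verts_append:
  "distinct (pair_verts (ps @ qs)) \<longleftrightarrow> distinct (pair_verts ps) \<and> distinct (pair_verts qs) \<and>
     set (pair_verts ps) \<inter> set (pair_verts qs) = {}"
proof -
  have "mset (pair_verts (ps @ qs)) = mset (pair_verts ps @ pair_verts qs)" by simp
  then have "distinct (pair_verts (ps @ qs)) \<longleftrightarrow> distinct (pair_verts ps @ pair_verts qs)"
    by (rule mset_eq_imp_distinct_iff)
  then show ?thesis by (simp only: distinct_append)
qed

text \<open>Carries a peeling of T over to a branch of the corona. There \<open>R\<close> is the
  hub, the additional neighbour of every branch vertex.\<close>

lemma peels_map:
  assumes "peels N S ps" "\<And>x. x \<in> fst ` set ps \<Longrightarrow> N' (g x) \<subseteq> g ` N x \<union> R" "g ` S \<union> R \<subseteq> S'"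
  shows "peels N' S' (map (map_prod g g) ps)"
  using assms
proof (induction ps arbitrary: S S')
  case (Cons p ps)
  obtain x y where p: "p = (x, y)" by fastforce
  have "N' (g x) \<subseteq> g ` N x \<union> R" using Cons.prems(2)[of x] p by simp
  moreover have "g ` N x \<subseteq> insert (g y) S'" using Cons.prems(1,3) p by auto
  ultimately have "N' (g x) \<subseteq> insert (g y) S'" using Cons.prems(3) by blast
  moreover have "peels N' (insert (g y) S') (map (map_prod g g) ps)"
    using Cons.prems p by (intro Cons.IH[of "insert y S"]) auto
  ultimately show ?case using p by simp
qed simp

text \<open>
  Processing the list from the left, Staller selects y, and then Dominator must reply with x, the
  only vertex left that dominates x. After these replies every win costs Dominator at least \<open>B\<close> moves.
\<close>

definition threats ::
  "nat \<Rightarrow> 'v pair_pre_digraph \<Rightarrow> 'v set \<Rightarrow> 'v set \<Rightarrow> ('v \<times> 'v) list \<Rightarrow> bool" where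
  "threats B K A S ps \<longleftrightarrow>
     peels (\<lambda>v. {u. (u, v) \<in> parcs K}) S ps \<and> distinct (pair_verts ps) \<and>
     set (pair_verts ps) \<subseteq> pverts K - (A \<union> S) \<and>
     (\<forall>A' S'. A \<union> fst ` set ps \<subseteq> A' \<and> S \<subseteq> S' \<and> position K A' S' \<and> dominating_set K A' \<longrightarrow> B \<le> card A')"

text \<open>Only x itself can still dominate x, so Dominator needs x and Staller wins by taking
  it.\<close>

definition cut_off :: "'v pair_pre_digraph \<Rightarrow> 'v set \<Rightarrow> 'v \<Rightarrow> bool" where
  "cut_off K S x \<longleftrightarrow> x \<in> pverts K \<and> (\<forall>u. (u, x) \<in> parcs K \<longrightarrow> u \<in> S)"

lemma cut_off_not_dominating:
  assumes "cut_off K S x" "position K A S" "x \<notin> A"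
  shows "\<not> dominating_set K A"
  using assms unfolding cut_off_def position_def dominating_set_def by blast

text \<open>\<open>KD\<close> and \<open>KS\<close> describe Staller's opening. They are extended by
  the forced phase, in which she works through a list of threats, and by the positions that
  Dominator has lost by ignoring one.\<close>

lemma threats_game_value_ge:
  fixes first :: player
  assumes fin: "finite (pverts K)"
    and init: "if first = Dominator then KD {} {} else KS {} {}"
    and dominator: "\<And>A S x. \<lbrakk>KD A S; position K A S; x \<in> pverts K - (A \<union> S)\<rbrakk> \<Longrightarrow> KS (insert x A) S"
    and staller: "\<And>A S. \<lbrakk>KS A S; position K A S\<rbrakk>
      \<Longrightarrow> (\<exists>x \<in> pverts K - (A \<union> S). KD A (insert x S)) \<or> (\<exists>ps. threats B K A S ps)"
    and won: "\<And>A S. \<lbrakk>KD A S \<or> KS A S; position K A S; dominating_set K A\<rbrakk> \<Longrightarrow> B \<le> card A"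
  shows "enat B \<le> game_value first K"
proof -
  \<comment> \<open>The vertex x is the forced reply to Staller's last move, and \<open>ps\<close>
    is the list that remains after it.\<close>
  define threatened where "threatened A S \<longleftrightarrow> (\<exists>x ps. x \<in> pverts K - (A \<union> S) \<and> cut_off K S x \<and>
    threats B K (insert x A) S ps)" for A S
  define KD' where "KD' A S \<longleftrightarrow> KD A S \<or> threatened A S \<or> threats B K A S [] \<or>
    (\<exists>x \<in> S. cut_off K S x)" for A S
  define KS' where "KS' A S \<longleftrightarrow> KS A S \<or> (\<exists>ps. threats B K A S ps) \<or>
    (\<exists>x. x \<notin> A \<and> cut_off K S x)" for A S
  \<comment> \<open>With no pair left, \<open>threats\<close> speaks only of the cost of later wins
    and so survives all further moves.\<close>
  have threats_mono: "threats B K A' S' []" if "threats B K A S []" "A \<subseteq> A'" "S \<subseteq> S'" for A S A' S'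
    using that unfolding threats_def by simp (meson order_trans)
  have cut_off_mono: "cut_off K (insert y S) x" if "cut_off K S x" for S x y
    using that by (auto simp: cut_off_def)
  show ?thesis
  proof (rule game_value_geI[where KD = KD' and KS = KS', OF fin])
    show "if first = Dominator then KD' {} {} else KS' {} {}"
      using init by (auto simp: KD'_def KS'_def)
  next
    fix A S x assume KD': "KD' A S" and pos: "position K A S" and x: "x \<in> pverts K - (A \<union> S)"
    consider "KD A S" | "threatened A S" | "threats B K A S []" | y where "y \<in> S" "cut_off K S y"
      using KD' KD'_def by blast
    then show "KS' (insert x A) S"
    proof cases
      case 1
      then show ?thesis using dominator[OF _ pos x] by (simp add: KS'_def)
    next
      case 2
      then obtain y ps where y: "y \<in> pverts K - (A \<union> S)" "cut_off K S y" "threats B K (insert y A) S ps"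
        by (auto simp: threatened_def)
      then show ?thesis by (cases "x = y") (auto simp: KS'_def)
    next
      case 3
      then show ?thesis using threats_mono[of A S "insert x A" S] by (auto simp: KS'_def)
    next
      case 4
      then show ?thesis using x pos by (auto simp: KS'_def position_def)
    qed
  next
    fix A S assume KS': "KS' A S" and pos: "position K A S" and nf: "\<not> pverts K \<subseteq> A \<union> S"
    have by_threats: "\<exists>x \<in> pverts K - (A \<union> S). KD' A (insert x S)" if ps: "threats B K A S ps" for ps
    proof (cases ps)
      case Nil
      obtain y where "y \<in> pverts K - (A \<union> S)" using nf by blast
      moreover have "threats B K A (insert y S) []" using threats_mono[of A S A] ps Nil by blast
      ultimately show ?thesis unfolding KD'_def by blast
    next
      case (Cons p qs)
      obtain x y where p: "p = (x, y)" by fastforce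
      have peel: "{u. (u, x) \<in> parcs K} \<subseteq> insert y S"
        "peels (\<lambda>v. {u. (u, v) \<in> parcs K}) (insert y S) qs"
        using ps unfolding threats_def Cons p by simp_all
      have dist: "distinct (pair_verts ps)" and sub: "set (pair_verts ps) \<subseteq> pverts K - (A \<union> S)"
        and last: "\<And>A' S'. \<lbrakk>A \<union> fst ` set ps \<subseteq> A'; S \<subseteq> S'; position K A' S'; dominating_set K A'\<rbrakk>
          \<Longrightarrow> B \<le> card A'"
        using ps unfolding threats_def by blast+
      have xy: "x \<in> pverts K - (A \<union> S)" "y \<in> pverts K - (A \<union> S)" "x \<noteq> y"
        using dist sub Cons p by auto
      have "threats B K (insert x A) (insert y S) qs"
        unfolding threats_def
      proof (intro conjI allI impI)
        show "distinct (pair_verts qs)" using dist Cons by auto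
        show "set (pair_verts qs) \<subseteq> pverts K - (insert x A \<union> insert y S)"
          using dist sub Cons p by auto
        fix A' S' assume "insert x A \<union> fst ` set qs \<subseteq> A' \<and> insert y S \<subseteq> S' \<and> position K A' S' \<and> dominating_set K A'"
        then show "B \<le> card A'" using last[of A' S'] Cons p by auto
      qed (rule peel)
      moreover have "cut_off K (insert y S) x" using peel xy by (auto simp: cut_off_def)
      ultimately have "threatened A (insert y S)" unfolding threatened_def using xy by blast
      then show ?thesis using xy by (auto simp: KD'_def)
    qed
    consider "KS A S" | ps where "threats B K A S ps" | x where "x \<notin> A" "cut_off K S x"
      using KS' KS'_def by blast
    then show "\<exists>x \<in> pverts K - (A \<union> S). KD' A (insert x S)"
    proof cases
      case 1
      then show ?thesis using staller[OF 1 pos] by_threats by (auto simp: KD'_def)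
    next
      case 2
      then show ?thesis by (rule by_threats)
    next
      case 3
      obtain y where y: "y \<in> pverts K - (A \<union> S)" using nf by blast
      have "x \<in> pverts K" using 3 by (simp add: cut_off_def)
      \<comment> \<open>If x is free, it is taken; otherwise it is Staller's already and any free
        vertex serves.\<close>
      then obtain z where "z \<in> pverts K - (A \<union> S)" "x \<in> insert z S" using 3 y by blast
      then show ?thesis using cut_off_mono[OF 3(2)] unfolding KD'_def by blast
    qed
  next
    fix A S assume K: "KD' A S \<or> KS' A S" and pos: "position K A S" and dom: "dominating_set K A"
    have iso: "x \<in> A" if "cut_off K S x" for x
      using cut_off_not_dominating[OF that pos] dom by blast
    have disj: "A \<inter> S = {}" using pos by (simp add: position_def)
    \<comment> \<open>Before the list is used up there is no win: even with y handed to Staller, x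
      is not dominated.\<close>
    have th: "B \<le> card A" if ps: "threats B K A S ps" for ps
    proof (cases ps)
      case Nil
      then show ?thesis using ps pos dom by (auto simp: threats_def)
    next
      case (Cons p qs)
      obtain x y where p: "p = (x, y)" by fastforce
      have xy: "{u. (u, x) \<in> parcs K} \<subseteq> insert y S" "x \<in> pverts K - (A \<union> S)" "y \<in> pverts K - (A \<union> S)"
        using ps unfolding threats_def Cons p by auto
      have "cut_off K (insert y S) x" using xy by (auto simp: cut_off_def)
      moreover have "position K A (insert y S)" using pos xy by (auto simp: position_def)
      ultimately have "\<not> dominating_set K A" by (rule cut_off_not_dominating) (use xy in simp)
      with dom show ?thesis by simp
    qed
    consider "KD A S \<or> KS A S" | "threatened A S" | ps where "threats B K A S ps"
      | x where "x \<in> S" "cut_off K S x" | x where "x \<notin> A" "cut_off K S x"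
      using K unfolding KD'_def KS'_def by blast
    then show "B \<le> card A"
    proof cases
      case 1
      then show ?thesis using won[OF _ pos dom] by blast
    next
      case 2
      then show ?thesis using iso by (auto simp: threatened_def)
    qed (use th iso disj in blast)+
  qed
qed

section \<open>Staller's lower bound in the corona of a tree\<close>

locale tree_corona = matched_corona +
  assumes acyclic: "acyclic_rel (parcs T)"
begin

text \<open>All neighbours of the \<open>m - 1\<close> peeled leaves are second components of pairs,
  so none of these leaves is z or adjacent to z. Dominating z takes one more vertex.\<close>

lemma ex_peels_T:
  assumes z: "z \<in> pverts T"
  obtains ps where "peels (\<lambda>w. {v. (v, w) \<in> parcs T}) {} ps" "distinct (pair_verts ps)"
    "set (pair_verts ps) \<subseteq> pverts T - {z}" "length ps = m - 1"
    "\<And>B. \<lbrakk>dominating_set T B; fst ` set ps \<subseteq> B\<rbrakk> \<Longrightarrow> m \<le> card B"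
proof -
  let ?N = "\<lambda>w. {v. (v, w) \<in> parcs T}"
  have "?N w \<subseteq> pverts T \<union> {}" for w using T_arcs by blast
  then obtain ps where ps: "peels ?N {} ps" "distinct (pair_verts ps)"
    "set (pair_verts ps) \<subseteq> pverts T - {z}" "card (pverts T) = 2 * length ps + 2"
    using ex_peels[OF T_sym T_irrefl acyclic finite_T matching z, of "{}"] by blast
  have len: "length ps = m - 1" using ps(4) by simp
  have "m \<le> card B" if B: "dominating_set T B" "fst ` set ps \<subseteq> B" for B
  proof -
    have "finite B" using B(1) finite_T unfolding dominating_set_def by (meson finite_subset)
    obtain w where w: "w \<in> B" "w = z \<or> w \<in> ?N z" using B(1) z by (auto simp: dominating_set_def)
    have "w \<notin> fst ` set ps"
    proof
      assume "w \<in> fst ` set ps"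
      moreover from this have "?N w \<subseteq> snd ` set ps" using peels_neighbours[OF ps(1)] by auto
      moreover have "w = z \<or> z \<in> ?N w" using w(2) T_sym by (auto simp: sym_def)
      ultimately show False using ps(3) by auto
    qed
    then have "card (insert w (fst ` set ps)) = Suc (card (set (map fst ps)))" by simp
    also have "card (set (map fst ps)) = length ps" using ps(2) distinct_card[of "map fst ps"] by simp
    finally have "m = card (insert w (fst ` set ps))" using len m_pos by simp
    also have "\<dots> \<le> card B" using w B \<open>finite B\<close> by (intro card_mono) auto
    finally show ?thesis .
  qed
  with ps len show thesis by (intro that) auto
qed

text \<open>If \<open>m\<close> is at least 2, a single vertex z cannot dominate T: the first leaf
  peeled off while avoiding z has its only neighbour different from z as well.\<close>

lemma card_dominating_set_T_ge:
  assumes B: "dominating_set T B"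
  shows "min 2 m \<le> card B"
proof (rule ccontr)
  assume less: "\<not> min 2 m \<le> card B"
  have fin: "finite B" using B finite_T unfolding dominating_set_def by (meson finite_subset)
  have "B \<noteq> {}" using B not_dominating_set_empty by auto
  then have "card B = 1" using less fin by (simp add: not_le) (metis card_gt_0_iff less_2_cases_iff not_gr0)
  then obtain z where z: "B = {z}" using card_1_singletonE by blast
  then have "z \<in> pverts T" using B by (auto simp: dominating_set_def)
  then obtain ps where ps: "peels (\<lambda>w. {v. (v, w) \<in> parcs T}) {} ps"
    "set (pair_verts ps) \<subseteq> pverts T - {z}" "length ps = m - 1"
    using ex_peels_T by metis
  then obtain x y qs where "ps = (x, y) # qs" using less \<open>card B = 1\<close> by (cases ps) auto
  then show False using ps B z by (auto simp: dominating_set_def)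
qed

text \<open>Every vertex of G costs at least one selected vertex, its hub or one in its
  branch.\<close>

lemma card_corona_set_ge:
  assumes A: "A \<subseteq> pverts H" and Q: "Q \<subseteq> pverts G"
    and ge: "\<And>u. u \<in> Q \<Longrightarrow> b \<le> card (branch A u)" and dom: "dominating_set H A"
  shows "card Q * b + (n - card Q) \<le> card A"
proof -
  have "(\<Sum>u \<in> pverts G. if u \<in> Q then b else 1) \<le> (\<Sum>u \<in> pverts G. of_bool (u \<in> hubs A) + card (branch A u))"
  proof (rule sum_mono)
    fix u assume u: "u \<in> pverts G"
    have "1 \<le> of_bool (u \<in> hubs A) + card (branch A u)"
    proof (cases "u \<in> hubs A")
      case False
      then have "dominating_set T (branch A u)" using u dom dominating_set_corona[OF A] by blast
      then have "min 2 m \<le> card (branch A u)" by (rule card_dominating_set_T_ge)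
      then show ?thesis using m_pos by simp
    qed simp
    then show "(if u \<in> Q then b else 1) \<le> of_bool (u \<in> hubs A) + card (branch A u)"
      using ge[of u] by auto
  qed
  also have "\<dots> = card (hubs A) + (\<Sum>u \<in> pverts G. card (branch A u))"
    using finite_G hubs_branch_subset(1)[OF A] by (simp add: sum.distrib Int_absorb1 flip: Int_def)
  also have "\<dots> = card A" using card_corona_set[OF A] by simp
  finally show ?thesis
    using finite_G Q by (simp add: sum.If_cases Int_absorb1 card_Diff_subset finite_subset
        flip: Diff_eq)
qed

text \<open>Induction over \<open>Q\<close>. In each branch z is the vertex that Dominator has
  there, if any, and T is peeled around it. The hub is Staller's and hence in \<open>S\<close>, and
  distinct branches are disjoint, so the lists can be joined.\<close>

lemma ex_peels_corona:
  assumes Q: "finite Q" "Q \<subseteq> pverts G" and pos: "position H A S"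
    and QS: "\<And>u. u \<in> Q \<Longrightarrow> u \<in> hubs S \<and> card (branch A u) \<le> 1"
  shows "\<exists>ps. peels (\<lambda>v. {u. (u, v) \<in> parcs H}) S ps \<and> distinct (pair_verts ps) \<and>
    set (pair_verts ps) \<subseteq> Inr ` (Q \<times> pverts T) - A \<and>
    (\<forall>A' u. u \<in> Q \<and> fst ` set ps \<subseteq> A' \<and> dominating_set T (branch A' u) \<longrightarrow> m \<le> card (branch A' u))"
  using Q QS
proof (induction Q rule: finite_induct)
  case empty
  then show ?case by (intro exI[of _ "[]"]) auto
next
  case (insert v Q)
  then obtain ps where ps: "peels (\<lambda>v. {u. (u, v) \<in> parcs H}) S ps" "distinct (pair_verts ps)"
    "set (pair_verts ps) \<subseteq> Inr ` (Q \<times> pverts T) - A"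
    "\<And>A' u. \<lbrakk>u \<in> Q; fst ` set ps \<subseteq> A'; dominating_set T (branch A' u)\<rbrakk> \<Longrightarrow> m \<le> card (branch A' u)"
    by auto
  have A: "A \<subseteq> pverts H" using pos by (simp add: position_def)
  have v: "v \<in> pverts G" "v \<in> hubs S" "card (branch A v) \<le> 1" using insert.prems by auto
  have "\<exists>z \<in> pverts T. branch A v \<subseteq> {z}"
  proof (cases "branch A v = {}")
    case True
    then show ?thesis using T_nonempty by blast
  next
    case False
    then obtain z where "z \<in> branch A v" by blast
    moreover have "\<forall>x \<in> branch A v. \<forall>y \<in> branch A v. x = y"
      using v(3) card_le_Suc0_iff_eq[OF finite_hubs_branch(2)[OF A]] by simp
    ultimately show ?thesis using hubs_branch_subset(2)[OF A] by blast
  qed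
  then obtain z where z: "z \<in> pverts T" "branch A v \<subseteq> {z}" by blast
  obtain qs where qs: "peels (\<lambda>w. {v. (v, w) \<in> parcs T}) {} qs" "distinct (pair_verts qs)"
    "set (pair_verts qs) \<subseteq> pverts T - {z}"
    "\<And>B. \<lbrakk>dominating_set T B; fst ` set qs \<subseteq> B\<rbrakk> \<Longrightarrow> m \<le> card B"
    using ex_peels_T[OF z(1)] by metis
  define g :: "'b \<Rightarrow> 'a + 'a \<times> 'b" where "g x = Inr (v, x)" for x
  let ?rs = "map (map_prod g g) qs"
  have g: "inj g" by (auto simp: g_def inj_def)
  have pv: "pair_verts ?rs = map g (pair_verts qs)" by (simp add: comp_def)
  have "peels (\<lambda>v. {u. (u, v) \<in> parcs H}) S ?rs"
  proof (rule peels_map[OF qs(1), where R = "{Inl v}"])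
    show "{u. (u, g x) \<in> parcs H} \<subseteq> g ` {v. (v, x) \<in> parcs T} \<union> {Inl v}" for x
      by (auto simp: g_def parcs_corona_branch[OF v(1)])
    show "g ` {} \<union> {Inl v} \<subseteq> S" using v by (simp add: hubs_def)
  qed
  then have "peels (\<lambda>v. {u. (u, v) \<in> parcs H}) S (ps @ ?rs)" by (rule peels_append[OF ps(1)])
  moreover have rs_sub: "set (pair_verts ?rs) \<subseteq> Inr ` ({v} \<times> pverts T) - A"
    unfolding pv using qs(3) z(2) by (fastforce simp: g_def branch_def)
  moreover have "distinct (pair_verts (ps @ ?rs))"
  proof -
    have "distinct (pair_verts ?rs)" unfolding pv using qs(2) g by (metis distinct_map inj_on_subset subset_UNIV)
    moreover have "set (pair_verts ps) \<inter> set (pair_verts ?rs) = {}"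
      using ps(3) rs_sub insert.hyps(2) by blast
    ultimately show ?thesis using ps(2) distinct_pair_verts_append by blast
  qed
  moreover have "set (pair_verts (ps @ ?rs)) \<subseteq> Inr ` (insert v Q \<times> pverts T) - A"
    using ps(3) rs_sub by auto
  moreover have "m \<le> card (branch A' u)"
    if "u \<in> insert v Q" "fst ` set (ps @ ?rs) \<subseteq> A'" "dominating_set T (branch A' u)" for A' u
  proof (cases "u = v")
    case True
    have "fst ` set qs \<subseteq> branch A' v" using that(2) by (force simp: branch_def g_def)
    then show ?thesis using qs(4) that(3) True by blast
  next
    case False
    then show ?thesis using ps(4)[of u A'] that by auto
  qed
  ultimately show ?case by (intro exI[of _ "ps @ ?rs"]) blast
qed

text \<open>\<open>Q\<close> collects Staller's hubs whose branches still allow \<open>m - 1\<close>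
  threats. It contains at least her share of the hubs; each of these branches costs \<open>m\<close>
  vertices and every other vertex of G at least one.\<close>

lemma ex_threats:
  assumes pos: "position H A S" and S: "S \<subseteq> Inl ` pverts G" and card: "card A = card S + d" and d: "d \<le> 1"
    and taken: "hubs A \<union> hubs S = pverts G"
  shows "\<exists>ps. threats ((n + d) div 2 + (n - (n + d) div 2) * m) H A S ps"
proof -
  have A: "A \<subseteq> pverts H" "S \<subseteq> pverts H" "A \<inter> S = {}" using pos by (auto simp: position_def)
  define Q where "Q = {u \<in> hubs S. card (branch A u) \<le> 1}"
  have QG: "Q \<subseteq> pverts G" using taken by (auto simp: Q_def)
  then have finQ: "finite Q" using finite_G finite_subset by blast
  obtain ps where ps: "peels (\<lambda>v. {u. (u, v) \<in> parcs H}) S ps" "distinct (pair_verts ps)"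
    "set (pair_verts ps) \<subseteq> Inr ` (Q \<times> pverts T) - A"
    "\<And>A' u. \<lbrakk>u \<in> Q; fst ` set ps \<subseteq> A'; dominating_set T (branch A' u)\<rbrakk> \<Longrightarrow> m \<le> card (branch A' u)"
    using ex_peels_corona[OF finQ QG pos] by (auto simp: Q_def)
  have disj: "hubs A \<inter> hubs S = {}" using A by (auto simp: hubs_def)
  have n: "card (hubs A) + card (hubs S) = n"
    using card_Un_disjoint[OF finite_hubs_branch(1) finite_hubs_branch(1) disj] A taken by simp
  have "S = Inl ` hubs S" using S by (auto simp: hubs_def)
  then have cS: "card S = card (hubs S)" by (metis card_image inj_Inl)
  \<comment> \<open>Each move of Dominator outside the hubs gives Staller half a hub more, and he needs two
    such moves to spoil one of her branches.\<close>
  have "card (hubs S - Q) * 2 = (\<Sum>u \<in> hubs S - Q. 2)" by simp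
  also have "\<dots> \<le> (\<Sum>u \<in> hubs S - Q. card (branch A u))"
    by (intro sum_mono) (auto simp: Q_def)
  also have "\<dots> \<le> (\<Sum>u \<in> pverts G. card (branch A u))"
    using taken finite_G by (intro sum_mono2) auto
  finally have "card (hubs A) + card (hubs S - Q) * 2 \<le> card (hubs S) + d"
    using card_corona_set[OF A(1)] card cS by simp
  moreover have QS: "Q \<subseteq> hubs S" by (auto simp: Q_def)
  moreover have "card Q \<le> card (hubs S)" using QS finite_hubs_branch A by (intro card_mono) auto
  ultimately have big: "n \<le> 2 * card Q + d"
    using card_Diff_subset[OF finQ QS] n by linarith
  have "threats ((n + d) div 2 + (n - (n + d) div 2) * m) H A S ps"
    unfolding threats_def
  proof (intro conjI allI impI)
    have "Inr ` (Q \<times> pverts T) \<subseteq> pverts H - S" using QG S by (auto simp: pverts_corona)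
    with ps(3) show "set (pair_verts ps) \<subseteq> pverts H - (A \<union> S)" by blast
  next
    fix A' S' assume "A \<union> fst ` set ps \<subseteq> A' \<and> S \<subseteq> S' \<and> position H A' S' \<and> dominating_set H A'"
    then have A': "fst ` set ps \<subseteq> A'" "S \<subseteq> S'" "A' \<subseteq> pverts H" "A' \<inter> S' = {}" "dominating_set H A'"
      by (auto simp: position_def)
    have "m \<le> card (branch A' u)" if u: "u \<in> Q" for u
    proof -
      \<comment> \<open>The hub u stays with Staller, so its branch must be dominated from
        within.\<close>
      have "u \<notin> hubs A'" using u A' by (auto simp: Q_def hubs_def)
      then have "dominating_set T (branch A' u)" using u QG A' dominating_set_corona[OF A'(3)] by blast
      then show ?thesis using ps(4) u A' by blast
    qed
    then have le: "card Q * m + (n - card Q) \<le> card A'" using A' QG by (intro card_corona_set_ge) auto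
    let ?c = "(n + d) div 2"
    have "n - ?c \<le> card Q" using big d by linarith
    then obtain j where j: "card Q = n - ?c + j" using le_Suc_ex by blast
    have "card Q \<le> n" using QG finite_G by (intro card_mono)
    moreover have "?c \<le> n" using d G_large by linarith
    ultimately have "?c = n - card Q + j" using j by linarith
    \<comment> \<open>Each of the j branches in \<open>Q\<close> beyond her share costs
      \<open>m\<close> instead of the 1 counted for it in \<open>?c\<close>.\<close>
    moreover have "j \<le> j * m" using m_pos by simp
    ultimately have "?c + (n - ?c) * m \<le> n - card Q + j * m + (n - ?c) * m" by linarith
    also have "\<dots> = card Q * m + (n - card Q)" unfolding j by (simp only: add_mult_distrib add_mult_distrib2 ac_simps)
    finally have "?c + (n - ?c) * m \<le> card Q * m + (n - card Q)" .
    with le show "?c + (n - ?c) * m \<le> card A'" by simp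
  qed (use ps in blast)+
  then show ?thesis ..
qed

text \<open>
  Covers the positions in which Staller is still selecting hubs: a branch without its hub needs two
  vertices of Dominator unless \<open>m = 1\<close>, and he has not made that many moves yet.
\<close>

lemma early_win_card_ge:
  assumes pos: "position H A S" and S: "S \<subseteq> Inl ` pverts G" and card: "card A \<le> card S + d" and d: "d \<le> 1"
    and dom: "dominating_set H A"
  shows "(n + d) div 2 + (n - (n + d) div 2) * m \<le> card A"
proof -
  have A: "A \<subseteq> pverts H" "S \<subseteq> pverts H" "A \<inter> S = {}" using pos by (auto simp: position_def)
  have c: "(n + d) div 2 \<le> n" using d G_large by linarith
  show ?thesis
  proof (cases "m = 1")
    case True
    \<comment> \<open>For \<open>m = 1\<close> the bound is n, one for each vertex of G.\<close>
    then show ?thesis using card_corona_set_ge[OF A(1), of "{}" 0] dom c by simp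
  next
    case False
    then have m: "2 \<le> m" using m_pos by linarith
    have "S = Inl ` hubs S" using S by (auto simp: hubs_def)
    then have cS: "card S = card (hubs S)" by (metis card_image inj_Inl)
    have HA: "hubs A \<subseteq> pverts G" and HS: "hubs S \<subseteq> pverts G"
      using hubs_branch_subset A by auto
    have disj: "hubs A \<inter> hubs S = {}" using A by (auto simp: hubs_def)
    have "card (hubs A) + card (hubs S) = card (hubs A \<union> hubs S)"
      using card_Un_disjoint[OF finite_hubs_branch(1) finite_hubs_branch(1) disj] A by simp
    also have "\<dots> \<le> n" using HA HS finite_G by (intro card_mono) auto
    finally have n: "card (hubs A) + card (hubs S) \<le> n" .
    have "card (pverts G - hubs A) * 2 + (n - card (pverts G - hubs A)) \<le> card A"
    proof (rule card_corona_set_ge[OF A(1) _ _ dom])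
      fix u assume "u \<in> pverts G - hubs A"
      then have "dominating_set T (branch A u)" using dom dominating_set_corona[OF A(1)] by blast
      from card_dominating_set_T_ge[OF this] m show "2 \<le> card (branch A u)" by simp
    qed simp
    moreover have "card (pverts G - hubs A) = n - card (hubs A)"
      using HA finite_hubs_branch A by (intro card_Diff_subset) auto
    \<comment> \<open>If Dominator has h hubs, the count gives
      \<open>2 * n - h \<le> card A\<close>, while \<open>card A\<close> is at most
      \<open>card S + d\<close> and so at most \<open>n - h + d\<close>.\<close>
    ultimately have "n \<le> d" using n card cS by linarith
    then show ?thesis using d G_large by simp
  qed
qed

lemma game_value_corona_ge:
  fixes first :: player
  defines "d \<equiv> (if first = Dominator then 1 else 0)"
  shows "enat ((n + d) div 2 + (n - (n + d) div 2) * m) \<le> game_value first H"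
proof -
  have d: "d \<le> 1" by (simp add: d_def)
  \<comment> \<open>In the opening Staller owns hubs only. The equations count the turns,
    \<open>d\<close> being Dominator's extra move when he starts.\<close>
  let ?KD = "\<lambda>A S. S \<subseteq> Inl ` pverts G \<and> card A + 1 = card S + d"
  let ?KS = "\<lambda>A S. S \<subseteq> Inl ` pverts G \<and> card A = card S + d"
  show ?thesis
  proof (rule threats_game_value_ge[where KD = ?KD and KS = ?KS, OF finite_H])
    show "if first = Dominator then ?KD {} {} else ?KS {} {}" by (simp add: d_def)
  next
    fix A S x assume "?KD A S" "position H A S" "x \<in> pverts H - (A \<union> S)"
    then show "?KS (insert x A) S"
      using finite_subset[OF _ finite_H, of A] by (auto simp: position_def)
  next
    fix A S assume KS: "?KS A S" and pos: "position H A S"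
    have A: "A \<subseteq> pverts H" "S \<subseteq> pverts H" using pos by (auto simp: position_def)
    show "(\<exists>x \<in> pverts H - (A \<union> S). ?KD A (insert x S)) \<or>
      (\<exists>ps. threats ((n + d) div 2 + (n - (n + d) div 2) * m) H A S ps)"
    proof (cases "hubs A \<union> hubs S = pverts G")
      case True
      then show ?thesis using ex_threats[OF pos _ _ d] KS by blast
    next
      case False
      then obtain u where u: "u \<in> pverts G" "u \<notin> hubs A" "u \<notin> hubs S"
        using hubs_branch_subset(1) A by blast
      then have "Inl u \<in> pverts H - (A \<union> S)" by (auto simp: pverts_corona hubs_def)
      moreover have "?KD A (insert (Inl u) S)"
        using KS u finite_subset[OF A(2) finite_H] by (auto simp: hubs_def)
      ultimately show ?thesis by blast
    qed
  next
    fix A S assume K: "?KD A S \<or> ?KS A S" and "position H A S" "dominating_set H A"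
    moreover from K have "S \<subseteq> Inl ` pverts G" "card A \<le> card S + d" by auto
    ultimately show "(n + d) div 2 + (n - (n + d) div 2) * m \<le> card A"
      using early_win_card_ge[OF _ _ _ d] by blast
  qed
qed

lemma game_value_corona:
  fixes first :: player
  defines "d \<equiv> (if first = Dominator then 1 else 0)"
  shows "game_value first H = enat ((n + d) div 2 + (n - (n + d) div 2) * m)"
  using game_value_corona_le[of first] game_value_corona_ge[of first] unfolding d_def by (rule antisym)

end

theorem theorem3p4:
  fixes G :: "'a pair_pre_digraph" and T :: "'b pair_pre_digraph"
  assumes "pair_graph G" and "graph_order G \<ge> 2"
    and "is_tree T" and "\<exists>M. perfect_matching T M"
  shows "gamma_MB (G \<odot> T) =
      enat (nat \<lceil>real (graph_order G) / 2\<rceil> + nat \<lfloor>real (graph_order G) / 2\<rfloor> * (graph_order T div 2)) \<and>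
    gamma_MB' (G \<odot> T) =
      enat (nat \<lfloor>real (graph_order G) / 2\<rfloor> + nat \<lceil>real (graph_order G) / 2\<rceil> * (graph_order T div 2))"
proof -
  have T: "pair_graph T" using assms(3) by (simp add: is_tree_def)
  obtain f where f: "matching_fun (parcs T) (pverts T) f"
    using assms(4) perfect_matching_matching_fun[OF T] by metis
  have "pverts T \<noteq> {}"
    using assms(3) by (auto simp: is_tree_def connected_def strongly_connected_def)
  then interpret tree_corona G T f
    by (intro tree_corona.intro matched_corona.intro tree_corona_axioms.intro
        assms T f is_tree_acyclic_rel)
  have floor: "nat \<lfloor>real n / 2\<rfloor> = n div 2" and ceil: "nat \<lceil>real n / 2\<rceil> = (n + 1) div 2" by linarith+
  \<comment> \<open>Dominator's share \<open>(n + d) div 2\<close> of the hubs is the ceiling for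
    \<open>d = 1\<close> and the floor for \<open>d = 0\<close>; Staller's share is the other
    one.\<close>
  have rest: "n - (n + 1) div 2 = n div 2" "n - n div 2 = (n + 1) div 2" by linarith+
  show ?thesis
    unfolding gamma_MB_def gamma_MB'_def floor ceil game_value_corona
    by (simp only: rest player.distinct simp_thms if_True if_False add_0_right)
qed

end
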